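(* Let $\Delta=\Delta(n)>1$ and $d=d(n)\ge 2$ be integers (possibly depending on the positive integer $n$), and let $p=p(n)\in[0,1]$ satisfy $p=\omega\left(\Delta^{12}\,n^{-1/\min\{2d,\Delta\}}\log^3 n\right)$. Then a random graph $G\sim\mathcal G(n,p)$ is with high probability $\mathcal H(n,\Delta,d)$-universal, i.e. the probability that $G$ simultaneously contains a copy of every graph $H\in\mathcal H(n,\Delta,d)$ tends to $1$ as $n\to\infty$.
   Context: All graphs are finite and simple. $\mathcal G(n,p)$ is the random graph on $n$ vertices in which each pair of vertices forms an edge independently with probability $p$. The maximum density of a graph $G$ is $d(G)=\max\{2|E(H)|/|V(H)| : H\subseteq G\}$, the maximum being over subgraphs $H$ with at least one vertex. $\mathcal H(n,\Delta,d)$ is the family of all graphs on $n$ vertices with maximum degree at most $\Delta$ and maximum density at most $d$. A graph $G$ is universal for a family $\mathcal H$ ($\mathcal H$-universal) if for every $H\in\mathcal H$ it contains a (not necessarily induced) subgraph isomorphic to $H$. "With high probability" means with probability tending to $1$ as $n\to\infty$; $f=\omega(g)$ means $f(n)/g(n)\to\infty$ as $n\to\infty$; $\log$ is the natural logarithm. *)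

theory Defs
  imports "HOL-Probability.Probability"
begin

text \<open>A graph is a pair of a vertex set and a set of edges, each edge being the two-element set
  of its endpoints.\<close>

type_synonym 'a graph = "'a set \<times> 'a set set"

abbreviation verts :: "'a graph \<Rightarrow> 'a set" where "verts G \<equiv> fst G"
abbreviation edges :: "'a graph \<Rightarrow> 'a set set" where "edges G \<equiv> snd G"

definition vertex_pairs :: "'a set \<Rightarrow> 'a set set" where
  "vertex_pairs V = {e. e \<subseteq> V \<and> card e = 2}"

definition simple_graph :: "'a graph \<Rightarrow> bool" where
  "simple_graph G \<longleftrightarrow> finite (verts G) \<and> edges G \<subseteq> vertex_pairs (verts G)"

definition subgraph :: "'a graph \<Rightarrow> 'a graph \<Rightarrow> bool" where
  "subgraph H G \<longleftrightarrow> simple_graph H \<and> verts H \<subseteq> verts G \<and> edges H \<subseteq> edges G"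

definition isomorphic :: "'a graph \<Rightarrow> 'b graph \<Rightarrow> bool" where
  "isomorphic G H \<longleftrightarrow>
     (\<exists>f. bij_betw f (verts G) (verts H) \<and> edges H = (\<lambda>e. f ` e) ` edges G)"

definition contains_copy :: "'a graph \<Rightarrow> 'b graph \<Rightarrow> bool" where
  "contains_copy G H \<longleftrightarrow> (\<exists>H'. subgraph H' G \<and> isomorphic H H')"

definition universal :: "'a graph \<Rightarrow> 'b graph set \<Rightarrow> bool" where
  "universal G \<H> \<longleftrightarrow> (\<forall>H\<in>\<H>. contains_copy G H)"

definition degree :: "'a graph \<Rightarrow> 'a \<Rightarrow> nat" where
  "degree G v = card {e \<in> edges G. v \<in> e}"

text \<open>The following two maxima are meaningful for finite graphs with at least one vertex.\<close>

definition max_degree :: "'a graph \<Rightarrow> nat" where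
  "max_degree G = Max (degree G ` verts G)"

definition max_density :: "'a graph \<Rightarrow> real" where
  "max_density G =
     Max {2 * real (card (edges H)) / real (card (verts H)) | H. subgraph H G \<and> verts H \<noteq> {}}"

text \<open>Taking vertices to be natural numbers is no restriction: up to isomorphism, every finite
  graph occurs.\<close>

definition graph_family :: "nat \<Rightarrow> nat \<Rightarrow> real \<Rightarrow> nat graph set" where
  "graph_family n \<Delta> d =
     {H. simple_graph H \<and> card (verts H) = n \<and> max_degree H \<le> \<Delta> \<and> max_density H \<le> d}"

definition random_graph :: "nat \<Rightarrow> real \<Rightarrow> nat graph pmf" where
  "random_graph n p =
     map_pmf (\<lambda>X. ({..<n}, {e \<in> vertex_pairs {..<n}. X e}))
       (Pi_pmf (vertex_pairs {..<n}) False (\<lambda>_. bernoulli_pmf p))"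

end

theory Submission
  imports Defs "HOL-Real_Asymp.Real_Asymp"
begin

text \<open>Let \<open>\<delta> = min d \<Delta>\<close> and \<open>D = min (2 d) \<Delta>\<close>, and expose \<open>G(n, p)\<close> as the union of two independent
  random graphs of density \<open>p\<^sub>1 \<ge> p / 2\<close>. With high probability every family of disjoint sets of
  size at most \<open>D\<close> satisfies Hall's condition into every fixed reservoir, up to an additive slack of
  \<open>x \<approx> D log n / p\<^sub>1 ^ D\<close> vertices (\<open>expands\<close>).

  Given \<open>H\<close>, pick a set of \<open>m\<close> vertices of common degree \<open>k \<le> \<delta>\<close> at pairwise distance at least \<open>5\<close>,
  and send their neighbourhoods onto disjoint \<open>k\<close>-cliques found in the first random graph. Every
  other vertex sees at most \<open>k\<close> of those neighbourhood vertices. Hence the other vertices can be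
  embedded with at most \<open>2 \<delta>\<close> back-neighbours in \<open>\<tau> = O(\<Delta>\<^sup>3 log n)\<close> layers of vertices at pairwise
  distance at least \<open>3\<close>, each by a Hall matching that wastes only \<open>x\<close> vertices. The \<open>m\<close> vertices
  are matched last, into exactly the unused vertices. As the cliques depend only on \<open>k\<close> and on the
  first random graph and not on \<open>H\<close>, the edges of the second one between them and the rest are
  still fresh, so no unused vertex is left without partners (\<open>covers\<close>).\<close>

section \<open>Matchings and expansion\<close>

text \<open>Induction on the number of sets. If every proper nonempty subfamily has a spare element,
  one set receives any of its elements and the others still satisfy Hall's condition without it.
  Otherwise a tight subfamily \<open>J\<close> is matched inside its union, and tightness passes the
  condition on to the remaining sets outside that union.\<close>

lemma hall_marriage:
  fixes A :: "'i \<Rightarrow> 'a set"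
  assumes "finite I" "\<And>i. i \<in> I \<Longrightarrow> finite (A i)"
    and "\<And>J. J \<subseteq> I \<Longrightarrow> card J \<le> card (\<Union> (A ` J))"
  shows "\<exists>g. inj_on g I \<and> (\<forall>i\<in>I. g i \<in> A i)"
  using assms
proof (induction "card I" arbitrary: I A rule: less_induct)
  case less
  note fin = less.prems(1) and finA = less.prems(2) and hall = less.prems(3)
  show ?case
  proof (cases "I = {}")
    case False
    then obtain i where i: "i \<in> I" by blast
    show ?thesis
    proof (cases "\<forall>J\<subseteq>I. J \<noteq> {} \<longrightarrow> J \<noteq> I \<longrightarrow> card J < card (\<Union> (A ` J))")
      case True
      have "card {i} \<le> card (\<Union> (A ` {i}))" using hall[of "{i}"] i by blast
      then have "A i \<noteq> {}" by auto
      then obtain x where x: "x \<in> A i" by blast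
      let ?I = "I - {i}" and ?A = "\<lambda>j. A j - {x}"
      have "\<exists>g. inj_on g ?I \<and> (\<forall>j\<in>?I. g j \<in> ?A j)"
      proof (rule less.hyps)
        show "card ?I < card I" using fin i by (rule card_Diff1_less)
      next
        fix J assume J: "J \<subseteq> ?I"
        show "card J \<le> card (\<Union> (?A ` J))"
        proof (cases "J = {}")
          case False
          then have "card J < card (\<Union> (A ` J))" using True J i by blast
          moreover have "\<Union> (?A ` J) = \<Union> (A ` J) - {x}" by blast
          moreover have "card (\<Union> (A ` J)) - 1 \<le> card (\<Union> (A ` J) - {x})"
            by (metis card_Diff_singleton diff_le_self card_Diff1_le Diff_empty Diff_insert0 order_refl)
          ultimately show ?thesis by simp
        qed simp
      qed (use fin finA in auto)
      then obtain g where g: "inj_on g ?I" "\<forall>j\<in>?I. g j \<in> ?A j" by blast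
      have "inj_on (g(i := x)) I" using g by (auto simp: inj_on_def)
      moreover have "\<forall>j\<in>I. (g(i := x)) j \<in> A j" using g x by auto
      ultimately show ?thesis by blast
    next
      case False
      then obtain J where J: "J \<subseteq> I" "J \<noteq> {}" "J \<noteq> I" "card (\<Union> (A ` J)) \<le> card J"
        by (meson not_le)
      have finJ: "finite J" using J fin finite_subset by blast
      have "card J < card I" using J fin by (simp add: psubset_card_mono psubset_eq)
      then have "\<exists>g. inj_on g J \<and> (\<forall>j\<in>J. g j \<in> A j)"
        by (rule less.hyps) (use J fin finJ finA hall in auto)
      then obtain g1 where g1: "inj_on g1 J" "\<forall>j\<in>J. g1 j \<in> A j" by blast
      let ?A = "\<lambda>j. A j - \<Union> (A ` J)"
      have "\<exists>g. inj_on g (I - J) \<and> (\<forall>j\<in>I - J. g j \<in> ?A j)"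
      proof (rule less.hyps)
        show "card (I - J) < card I"
          using J fin by (intro psubset_card_mono) auto
      next
        fix K assume K: "K \<subseteq> I - J"
        have finK: "finite K" using K fin finite_subset by blast
        have finU: "finite (\<Union> (A ` (K \<union> J)))" using K J finA finK finJ by blast
        have "card K + card J = card (K \<union> J)"
          using K finK finJ by (subst card_Un_disjoint) auto
        also have "\<dots> \<le> card (\<Union> (A ` (K \<union> J)))" using hall[of "K \<union> J"] K J by blast
        also have "\<Union> (A ` (K \<union> J)) = \<Union> (?A ` K) \<union> \<Union> (A ` J)" by blast
        also have "card \<dots> \<le> card (\<Union> (?A ` K)) + card (\<Union> (A ` J))" by (rule card_Un_le)
        finally show "card K \<le> card (\<Union> (?A ` K))" using J(4) by linarith
      qed (use fin finA in auto)
      then obtain g2 where g2: "inj_on g2 (I - J)" "\<forall>j\<in>I - J. g2 j \<in> ?A j" by blast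
      let ?g = "\<lambda>j. if j \<in> J then g1 j else g2 j"
      have ne: "g1 u \<noteq> g2 v" if "u \<in> J" "v \<in> I - J" for u v
        using g1(2) g2(2) that by (metis DiffD2 UN_I)
      have "inj_on ?g I"
      proof (rule inj_onI)
        fix a b assume ab: "a \<in> I" "b \<in> I" "?g a = ?g b"
        show "a = b"
          using ab ne[of a b] ne[of b a] inj_onD[OF g1(1), of a b] inj_onD[OF g2(1), of a b]
          by (auto split: if_splits)
      qed
      moreover have "\<forall>j\<in>I. ?g j \<in> A j" using g1 g2 by auto
      ultimately show ?thesis by (intro exI[of _ ?g]) simp
    qed
  qed auto
qed

text \<open>Greedy choice: pick \<open>u\<close>, discard the at most \<open>c\<close> elements of
  \<open>C u\<close>, repeat. By symmetry of \<open>C\<close> it is enough that later picks avoid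
  the earlier sets. With balls as \<open>C u\<close> this yields vertices that are pairwise far
  apart.\<close>

lemma exists_large_independent_subset:
  assumes "finite A" "\<And>u. u \<in> A \<Longrightarrow> u \<in> C u" "\<And>u. u \<in> A \<Longrightarrow> finite (C u) \<and> card (C u) \<le> c"
    and "\<And>u v. v \<in> C u \<Longrightarrow> u \<in> C v"
  shows "\<exists>W\<subseteq>A. card A \<le> c * card W \<and> (\<forall>u\<in>W. \<forall>v\<in>W. u \<noteq> v \<longrightarrow> v \<notin> C u)"
  using assms(1-3)
proof (induction "card A" arbitrary: A rule: less_induct)
  case less
  show ?case
  proof (cases "A = {}")
    case False
    then obtain u where u: "u \<in> A" by blast
    let ?A = "A - C u"
    have "card ?A < card A"
      using less.prems u by (intro psubset_card_mono) auto
    from less.hyps[OF this] less.prems obtain W where W: "W \<subseteq> ?A" "card ?A \<le> c * card W"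
      "\<forall>u\<in>W. \<forall>v\<in>W. u \<noteq> v \<longrightarrow> v \<notin> C u"
      by (metis (no_types, lifting) DiffD1 finite_Diff)
    have finW: "finite W" using W less.prems finite_subset by blast
    have "u \<notin> W" using W less.prems u by auto
    have "card A \<le> card ?A + card (C u)"
      using less.prems u by (metis card_Un_le card_mono finite_UnI finite_Diff Un_Diff_cancel2 Un_upper1 le_trans)
    then have "card A \<le> c * card (insert u W)"
      using W(2) less.prems(3)[OF u] finW \<open>u \<notin> W\<close> by simp
    moreover have "\<forall>a\<in>insert u W. \<forall>b\<in>insert u W. a \<noteq> b \<longrightarrow> b \<notin> C a"
      using W assms(4) by blast
    moreover have "insert u W \<subseteq> A" using W u by blast
    ultimately show ?thesis by blast
  qed auto
qed

section \<open>Expansion into reservoirs\<close>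

definition hits :: "(nat set \<Rightarrow> bool) \<Rightarrow> ('i \<Rightarrow> nat set) \<Rightarrow> 'i set \<Rightarrow> nat set \<Rightarrow> bool" where
  "hits X F S Y \<longleftrightarrow> (\<exists>j\<in>S. \<exists>v\<in>Y. \<forall>u\<in>F j. X {u, v})"

text \<open>Think of \<open>Z\<close> as all vertices of the reservoir \<open>I\<close> that the
  sets \<open>F j\<close> reach. A violation of Hall's condition has \<open>card Z < s\<close>, and
  this is ruled out as long as at least \<open>x\<close> vertices of \<open>I\<close> lie outside
  \<open>Z\<close>. Indexing by an initial segment lets a union bound count the families.\<close>

definition expands :: "(nat set \<Rightarrow> bool) \<Rightarrow> nat \<Rightarrow> nat \<Rightarrow> nat \<Rightarrow> nat set \<Rightarrow> bool" where
  "expands X n D x I \<longleftrightarrow> (\<forall>s F Z. 0 < s \<and> s \<le> n \<and> (\<forall>j<s. F j \<subseteq> {..<n} - I \<and> card (F j) \<le> D) \<and>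
     disjoint_family_on F {..<s} \<and> Z \<subseteq> I \<and> card Z < s \<and> x \<le> card (I - Z) \<longrightarrow> hits X F {..<s} (I - Z))"

lemma expands_hits:
  assumes "expands X n D x I" "finite S" "S \<noteq> {}" "card S \<le> n"
    and "\<And>j. j \<in> S \<Longrightarrow> F j \<subseteq> {..<n} - I \<and> card (F j) \<le> D" "disjoint_family_on F S"
    and "Z \<subseteq> I" "card Z < card S" "x \<le> card (I - Z)"
  shows "hits X F S (I - Z)"
proof -
  obtain h where h: "bij_betw h {..<card S} S"
    using assms(2) ex_bij_betw_nat_finite[of S] by (auto simp: atLeast0LessThan)
  have hS: "h j \<in> S" if "j < card S" for j using h that by (auto simp: bij_betw_def)
  have dj: "disjoint_family_on (F \<circ> h) {..<card S}"
    unfolding disjoint_family_on_def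
  proof (intro ballI impI)
    fix i j assume "i \<in> {..<card S}" "j \<in> {..<card S}" "i \<noteq> j"
    then have "h i \<noteq> h j" "h i \<in> S" "h j \<in> S"
      using h by (auto simp: bij_betw_def inj_on_def)
    then show "(F \<circ> h) i \<inter> (F \<circ> h) j = {}"
      using assms(6) by (simp add: disjoint_family_on_def)
  qed
  have "hits X (F \<circ> h) {..<card S} (I - Z)"
    using assms(1) unfolding expands_def
    by (elim allE[of _ "card S"] allE[of _ "F \<circ> h"] allE[of _ Z])
      (use assms hS dj in \<open>auto simp: card_gt_0_iff\<close>)
  then show ?thesis using hS by (auto simp: hits_def)
qed

text \<open>The candidates of a violating \<open>J\<close> would leave at least \<open>x\<close>
  vertices of \<open>I\<close> over, as \<open>I\<close> has \<open>x\<close> more vertices than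
  \<open>W\<close> needs. Expansion then produces a candidate outside the set of all
  candidates.\<close>

lemma expands_matching:
  assumes "expands X n D x I" "I \<subseteq> {..<n}" "finite W" "card W + x \<le> card I"
    and "\<And>w. w \<in> W \<Longrightarrow> F w \<subseteq> {..<n} - I \<and> card (F w) \<le> D" "disjoint_family_on F W"
  shows "\<exists>g. inj_on g W \<and> (\<forall>w\<in>W. g w \<in> I \<and> (\<forall>u\<in>F w. X {u, g w}))"
proof -
  define A where "A w = {v \<in> I. \<forall>u\<in>F w. X {u, v}}" for w
  have finI: "finite I" using assms(2) finite_subset by blast
  have "card I \<le> n" using card_mono[OF _ assms(2)] by simp
  have "\<exists>g. inj_on g W \<and> (\<forall>i\<in>W. g i \<in> A i)"
  proof (rule hall_marriage)
    fix J assume J: "J \<subseteq> W"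
    show "card J \<le> card (\<Union> (A ` J))"
    proof (rule ccontr)
      assume neg: "\<not> ?thesis"
      have finJ: "finite J" using J assms(3) finite_subset by blast
      have cJ: "card J \<le> card W" using J assms(3) by (simp add: card_mono)
      have sub: "\<Union> (A ` J) \<subseteq> I" by (auto simp: A_def)
      have "hits X F J (I - \<Union> (A ` J))"
      proof (rule expands_hits[OF assms(1) finJ])
        show "J \<noteq> {}" using neg by auto
        show "card J \<le> n" using cJ assms(4) \<open>card I \<le> n\<close> by linarith
        show "disjoint_family_on F J" using assms(6) J by (meson disjoint_family_on_mono)
        show "x \<le> card (I - \<Union> (A ` J))"
          using neg cJ assms(4) finI sub by (subst card_Diff_subset) (auto intro: finite_subset)
      qed (use J assms(5) sub neg in auto)
      then show False by (auto simp: hits_def A_def)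
    qed
  qed (use assms(3) finI in \<open>auto simp: A_def\<close>)
  then show ?thesis by (auto simp: A_def)
qed

text \<open>All \<open>m\<close> cliques grow together, one vertex per round, each round being a
  matching into the next interval of length \<open>m + x\<close>. The last round extends sets of
  \<open>k - 1\<close> vertices, whence \<open>k <= D + 1\<close>.\<close>

lemma exists_disjoint_cliques:
  assumes "\<And>a b. a \<le> b \<Longrightarrow> b \<le> n \<Longrightarrow> expands X n D x {a..<b}" "k * (m + x) \<le> n" "k \<le> D + 1"
  shows "\<exists>q. disjoint_family_on q {..<m} \<and> (\<forall>j<m. q j \<subseteq> {..<k * (m + x)} \<and> card (q j) = k \<and>
           (\<forall>u\<in>q j. \<forall>v\<in>q j. u \<noteq> v \<longrightarrow> X {u, v}))"
  using assms(2,3)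
proof (induction k)
  case 0
  show ?case by (intro exI[of _ "\<lambda>_. {}"]) (auto simp: disjoint_family_on_def)
next
  case (Suc k)
  let ?a = "k * (m + x)" and ?b = "Suc k * (m + x)"
  obtain q where q: "disjoint_family_on q {..<m}" "\<And>j. j < m \<Longrightarrow> q j \<subseteq> {..<?a}"
    "\<And>j. j < m \<Longrightarrow> card (q j) = k"
    "\<And>j u v. j < m \<Longrightarrow> u \<in> q j \<Longrightarrow> v \<in> q j \<Longrightarrow> u \<noteq> v \<Longrightarrow> X {u, v}"
    using Suc by auto
  have "expands X n D x {?a..<?b}" using Suc.prems by (intro assms(1)) auto
  then have "\<exists>g. inj_on g {..<m} \<and> (\<forall>w\<in>{..<m}. g w \<in> {?a..<?b} \<and> (\<forall>u\<in>q w. X {u, g w}))"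
  proof (rule expands_matching)
    fix w assume "w \<in> {..<m}"
    then show "q w \<subseteq> {..<n} - {?a..<?b} \<and> card (q w) \<le> D"
      using q(2,3)[of w] Suc.prems by fastforce
  qed (use q Suc.prems in auto)
  then obtain g where g: "inj_on g {..<m}" "\<And>j. j < m \<Longrightarrow> g j \<in> {?a..<?b}"
    "\<And>j u. j < m \<Longrightarrow> u \<in> q j \<Longrightarrow> X {u, g j}" by auto
  let ?q = "\<lambda>j. insert (g j) (q j)"
  have gq: "g i \<notin> q j" if "i < m" "j < m" for i j using g(2)[of i] q(2)[of j] that by auto
  have "disjoint_family_on ?q {..<m}"
    using q(1) g(1) gq by (auto simp: disjoint_family_on_def inj_on_def)
  moreover have "?q j \<subseteq> {..<?b} \<and> card (?q j) = Suc k \<and> (\<forall>u\<in>?q j. \<forall>v\<in>?q j. u \<noteq> v \<longrightarrow> X {u, v})"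
    if j: "j < m" for j
  proof (intro conjI)
    have fin: "finite (q j)" using q(2)[OF j] finite_subset by blast
    show "card (?q j) = Suc k" using fin gq[OF j j] q(3)[OF j] by simp
    show "?q j \<subseteq> {..<?b}" using q(2)[OF j] g(2)[OF j] by auto
    show "\<forall>u\<in>?q j. \<forall>v\<in>?q j. u \<noteq> v \<longrightarrow> X {u, v}"
      using q(4)[OF j] g(3)[OF j] by (auto simp: insert_commute)
  qed
  ultimately show ?case by (intro exI[of _ ?q]) auto
qed

section \<open>Layers of sparse graphs\<close>

lemma exists_inj_on_blocks:
  assumes "disjoint_family_on A I" "disjoint_family_on B I"
    and "\<And>i. i \<in> I \<Longrightarrow> finite (A i) \<and> finite (B i) \<and> card (A i) = card (B i)"
  shows "\<exists>f. inj_on f (\<Union>i\<in>I. A i) \<and> (\<forall>i\<in>I. f ` A i = B i)"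
proof -
  have "\<forall>i\<in>I. \<exists>h. bij_betw h (A i) (B i)" using assms(3) by (meson finite_same_card_bij)
  then obtain h where h: "\<And>i. i \<in> I \<Longrightarrow> bij_betw (h i) (A i) (B i)" by metis
  define ix where "ix u = (SOME i. i \<in> I \<and> u \<in> A i)" for u
  have ix: "ix u = i" if "i \<in> I" "u \<in> A i" for i u
  proof -
    have "ix u \<in> I \<and> u \<in> A (ix u)" unfolding ix_def by (rule someI[of _ i]) (use that in simp)
    then show ?thesis using assms(1) that by (auto simp: disjoint_family_on_def)
  qed
  define f where "f u = h (ix u) u" for u
  have im: "f ` A i = B i" if "i \<in> I" for i
  proof -
    have "f ` A i = h i ` A i" using ix that by (auto simp: f_def)
    then show ?thesis using h[OF that] by (simp add: bij_betw_def)
  qed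
  have "inj_on f (\<Union>i\<in>I. A i)"
  proof (rule inj_onI)
    fix u v assume "u \<in> (\<Union>i\<in>I. A i)" "v \<in> (\<Union>i\<in>I. A i)" and eq: "f u = f v"
    then obtain i j where ij: "i \<in> I" "u \<in> A i" "j \<in> I" "v \<in> A j" by blast
    have "f u \<in> B i" "f v \<in> B j" using im ij by blast+
    then have "i = j" using eq assms(2) ij by (auto simp: disjoint_family_on_def)
    then show "u = v" using eq ij h[of i] ix by (auto simp: f_def bij_betw_def inj_on_def)
  qed
  then show ?thesis using im by blast
qed

text \<open>Lengthening the prefix by one adds at most one element, so every smaller count is
  attained. This cuts reservoirs to an exact size.\<close>

lemma exists_prefix_card_Diff:
  fixes Q :: "nat set"
  assumes "l \<le> card ({..<a} - Q)"
  shows "\<exists>b\<le>a. card ({..<b} - Q) = l"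
  using assms
proof (induction a)
  case (Suc a)
  show ?case
  proof (cases "l \<le> card ({..<a} - Q)")
    case True
    then show ?thesis using Suc.IH le_SucI by blast
  next
    case False
    have sub: "{..<Suc a} - Q \<subseteq> insert a ({..<a} - Q)" by auto
    then have "card ({..<Suc a} - Q) \<le> Suc (card ({..<a} - Q))"
      using card_mono[OF _ sub] by (simp add: card_insert_if split: if_splits)
    then show ?thesis using Suc.prems False by (intro exI[of _ "Suc a"]) auto
  qed
qed auto

text \<open>\<open>sum_degrees_le\<close> bounds the average degree of every induced subgraph; this
  is the form in which the density bound enters, with \<open>min d \<Delta>\<close> for
  \<open>\<delta>\<close>.\<close>

locale sparse_graph =
  fixes V :: "'a set" and E :: "'a set set" and \<Delta> \<delta> :: nat
  assumes finite_V: "finite V" and E: "E \<subseteq> vertex_pairs V"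
    and degree_le: "\<And>v. v \<in> V \<Longrightarrow> card {u. {u, v} \<in> E} \<le> \<Delta>"
    and sum_degrees_le: "\<And>R. R \<subseteq> V \<Longrightarrow> (\<Sum>v\<in>R. card ({u. {u, v} \<in> E} \<inter> R)) \<le> \<delta> * card R"
    and \<delta>_le: "\<delta> \<le> \<Delta>"
begin

definition N :: "'a \<Rightarrow> 'a set" where "N v = {u. {u, v} \<in> E}"

lemma N_sym: "u \<in> N v \<longleftrightarrow> v \<in> N u"
  by (simp add: N_def insert_commute)

lemma N_subset: "N v \<subseteq> V" and N_irrefl: "v \<notin> N v" and N_outside: "v \<notin> V \<Longrightarrow> N v = {}"
  using E by (auto simp: N_def vertex_pairs_def card_insert_if)

lemma edge_iff: "{u, v} \<in> E \<longleftrightarrow> u \<in> N v"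
  by (simp add: N_def)

lemma finite_N: "finite (N v)"
  using N_subset finite_V finite_subset by blast

lemma card_N: "card (N v) \<le> \<Delta>"
  using degree_le[of v] N_outside[of v] by (cases "v \<in> V") (auto simp: N_def)

text \<open>The ball of radius \<open>i\<close>. Writing it as a relation power makes radii add, as
  \<open>nbhd_4I\<close> needs.\<close>

definition nbhd :: "nat \<Rightarrow> 'a \<Rightarrow> 'a set" where
  "nbhd i u = ({(u, v). u = v \<or> u \<in> N v} ^^ i) `` {u}"

lemma nbhd_Suc: "nbhd (Suc i) u = nbhd i u \<union> (\<Union>v\<in>nbhd i u. N v)"
  by (auto simp: nbhd_def N_sym)

lemma nbhd_0: "nbhd 0 u = {u}"
  by (simp add: nbhd_def)

lemma nbhd_refl: "u \<in> nbhd i u"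
  by (induction i) (auto simp: nbhd_0 nbhd_Suc)

lemma nbhd_sym: "v \<in> nbhd i u \<Longrightarrow> u \<in> nbhd i v"
proof -
  have "(u, v) \<in> {(u, v). u = v \<or> u \<in> N v} ^^ i \<Longrightarrow> (v, u) \<in> {(u, v). u = v \<or> u \<in> N v} ^^ i" for u v
  proof (induction i arbitrary: v)
    case (Suc i)
    then obtain w where w: "(u, w) \<in> {(u, v). u = v \<or> u \<in> N v} ^^ i" "w = v \<or> w \<in> N v" by auto
    show ?case using N_sym w by (intro relpow_Suc_I2[OF _ Suc.IH[OF w(1)]]) auto
  qed auto
  then show "v \<in> nbhd i u \<Longrightarrow> u \<in> nbhd i v" by (simp add: nbhd_def)
qed

lemma nbhd_card: "finite (nbhd i u) \<and> card (nbhd i u) \<le> (\<Delta> + 1) ^ i"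
proof (induction i)
  case (Suc i)
  have "card (\<Union>v\<in>nbhd i u. N v) \<le> (\<Sum>v\<in>nbhd i u. card (N v))"
    using Suc by (intro card_UN_le) auto
  also have "\<dots> \<le> card (nbhd i u) * \<Delta>"
    using sum_bounded_above[of "nbhd i u" "\<lambda>v. card (N v)" \<Delta>] card_N by simp
  finally have "card (nbhd (Suc i) u) \<le> card (nbhd i u) + card (nbhd i u) * \<Delta>"
    unfolding nbhd_Suc using card_Un_le le_trans add_left_mono by meson
  also have "\<dots> = (\<Delta> + 1) * card (nbhd i u)" by (simp add: algebra_simps)
  also have "\<dots> \<le> (\<Delta> + 1) ^ Suc i" using Suc by (simp only: power_Suc mult_le_mono2)
  finally show ?case using Suc finite_N by (auto simp: nbhd_Suc)
qed (simp add: nbhd_0)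

text \<open>Markov's inequality for integral degrees: each vertex of inner degree above
  \<open>\<delta>\<close> contributes at least \<open>\<delta> + 1\<close> to a sum of at most
  \<open>\<delta> * card R\<close>, so such vertices make up at most the fraction
  \<open>\<delta> / (\<delta> + 1)\<close> of \<open>R\<close>.\<close>

lemma card_low_degree:
  assumes "R \<subseteq> V"
  shows "card R \<le> (\<delta> + 1) * card {v \<in> R. card (N v \<inter> R) \<le> \<delta>}"
proof -
  let ?L = "{v \<in> R. card (N v \<inter> R) \<le> \<delta>}"
  have fin: "finite R" using assms finite_V finite_subset by blast
  have "(\<delta> + 1) * card (R - ?L) \<le> (\<Sum>v\<in>R - ?L. card (N v \<inter> R))"
  proof -
    have "of_nat (card (R - ?L)) * (\<delta> + 1) \<le> (\<Sum>v\<in>R - ?L. card (N v \<inter> R))"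
      by (rule sum_bounded_below) auto
    then show ?thesis by (simp add: mult.commute)
  qed
  also have "\<dots> \<le> (\<Sum>v\<in>R. card (N v \<inter> R))" using fin by (intro sum_mono2) auto
  also have "\<dots> \<le> \<delta> * card R" using sum_degrees_le[OF assms] by (simp add: N_def)
  finally have "(\<delta> + 1) * card (R - ?L) \<le> \<delta> * card R" .
  moreover have "card R = card (R - ?L) + card ?L"
    using fin by (metis (no_types, lifting) card_Diff_subset card_mono finite_subset le_add_diff_inverse2 mem_Collect_eq subsetI)
  ultimately show ?thesis by (simp add: algebra_simps)
qed

text \<open>Thinning the low-degree vertices by balls of radius two costs a factor
  \<open>(\<Delta> + 1)^2\<close>. Distance at least three makes \<open>W\<close> independent with
  disjoint neighbourhoods, so that a single Hall matching can embed it.\<close>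

lemma exists_layer:
  assumes "R \<subseteq> V"
  shows "\<exists>W\<subseteq>R. card R \<le> (\<delta> + 1) * (\<Delta> + 1)\<^sup>2 * card W \<and> (\<forall>w\<in>W. card (N w \<inter> R) \<le> \<delta>) \<and>
    (\<forall>u\<in>W. \<forall>v\<in>W. u \<noteq> v \<longrightarrow> v \<notin> nbhd 2 u)"
proof -
  let ?L = "{v \<in> R. card (N v \<inter> R) \<le> \<delta>}"
  have "finite R" using assms finite_V by (rule finite_subset)
  then have "finite ?L" by simp
  then have "\<exists>W\<subseteq>?L. card ?L \<le> (\<Delta> + 1)\<^sup>2 * card W \<and> (\<forall>u\<in>W. \<forall>v\<in>W. u \<noteq> v \<longrightarrow> v \<notin> nbhd 2 u)"
    by (rule exists_large_independent_subset) (use nbhd_refl nbhd_card nbhd_sym in auto)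
  then obtain W where W: "W \<subseteq> ?L" "card ?L \<le> (\<Delta> + 1)\<^sup>2 * card W"
    "\<forall>u\<in>W. \<forall>v\<in>W. u \<noteq> v \<longrightarrow> v \<notin> nbhd 2 u" by blast
  have "card R \<le> (\<delta> + 1) * card ?L" by (rule card_low_degree[OF assms])
  also have "\<dots> \<le> (\<delta> + 1) * ((\<Delta> + 1)\<^sup>2 * card W)" using W(2) by (rule mult_le_mono2)
  also have "\<dots> = (\<delta> + 1) * (\<Delta> + 1)\<^sup>2 * card W" by (simp only: mult.assoc)
  finally show ?thesis using W by (intro exI[of _ W]) blast
qed

text \<open>One factor \<open>\<delta> + 1\<close> pays for low degree, the other for the pigeonhole
  choice of a common degree \<open>k\<close>, and the fourth power for thinning by balls of radius
  four. Thanks to the common degree, one family of \<open>k\<close>-cliques serves all graphs with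
  the same \<open>k\<close>.\<close>

lemma exists_last_layer:
  assumes "m * ((\<delta> + 1)\<^sup>2 * (\<Delta> + 1) ^ 4) \<le> card V"
  shows "\<exists>k\<le>\<delta>. \<exists>W\<subseteq>V. card W = m \<and> (\<forall>w\<in>W. card (N w) = k) \<and>
    (\<forall>u\<in>W. \<forall>v\<in>W. u \<noteq> v \<longrightarrow> v \<notin> nbhd 4 u)"
proof -
  let ?L = "{v \<in> V. card (N v \<inter> V) \<le> \<delta>}" and ?A = "\<lambda>k. {v \<in> V. card (N v) = k}"
  have NV: "N v \<inter> V = N v" for v using N_subset by blast
  have "\<exists>k\<le>\<delta>. card ?L \<le> (\<delta> + 1) * card (?A k)"
  proof (rule ccontr)
    assume "\<not> ?thesis"
    then have less: "(\<delta> + 1) * card (?A k) < card ?L" if "k \<le> \<delta>" for k using that by (meson not_le)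
    have "?L = (\<Union>k\<in>{..\<delta>}. ?A k)" using NV by auto
    then have "card ?L \<le> (\<Sum>k\<le>\<delta>. card (?A k))" by (metis (no_types) card_UN_le finite_atMost)
    then have "(\<delta> + 1) * card ?L \<le> (\<Sum>k\<le>\<delta>. (\<delta> + 1) * card (?A k))"
      unfolding sum_distrib_left[symmetric] by (rule mult_le_mono2)
    also have "\<dots> < (\<Sum>k\<le>\<delta>. card ?L)" using less by (intro sum_strict_mono) auto
    finally show False by simp
  qed
  then obtain k where k: "k \<le> \<delta>" "card ?L \<le> (\<delta> + 1) * card (?A k)" by blast
  have "finite (?A k)" using finite_V by auto
  then have "\<exists>W\<subseteq>?A k. card (?A k) \<le> (\<Delta> + 1) ^ 4 * card W \<and> (\<forall>u\<in>W. \<forall>v\<in>W. u \<noteq> v \<longrightarrow> v \<notin> nbhd 4 u)"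
    by (rule exists_large_independent_subset) (use nbhd_refl nbhd_card nbhd_sym in auto)
  then obtain W where W: "W \<subseteq> ?A k" "card (?A k) \<le> (\<Delta> + 1) ^ 4 * card W"
    "\<forall>u\<in>W. \<forall>v\<in>W. u \<noteq> v \<longrightarrow> v \<notin> nbhd 4 u" by blast
  have "m * ((\<delta> + 1)\<^sup>2 * (\<Delta> + 1) ^ 4) \<le> card V" by fact
  also have "\<dots> \<le> (\<delta> + 1) * card ?L" by (rule card_low_degree) simp
  also have "\<dots> \<le> (\<delta> + 1) * ((\<delta> + 1) * ((\<Delta> + 1) ^ 4 * card W))"
    using k(2) W(2) by (meson le_trans mult_le_mono2)
  also have "\<dots> = card W * ((\<delta> + 1)\<^sup>2 * (\<Delta> + 1) ^ 4)"
    by (simp add: power2_eq_square mult.commute mult.left_commute del: mult_Suc mult_Suc_right add_Suc_right)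
  finally have "m \<le> card W" using mult_le_cancel2 by (metis add_gr_0 mult_pos_pos zero_less_one zero_less_power)
  then obtain W' where W': "W' \<subseteq> W" "card W' = m" by (meson obtain_subset_with_card_n)
  have "W' \<subseteq> V" "\<forall>w\<in>W'. card (N w) = k" using W'(1) W(1) by auto
  moreover have "\<forall>u\<in>W'. \<forall>v\<in>W'. u \<noteq> v \<longrightarrow> v \<notin> nbhd 4 u" using W'(1) W(3) by blast
  ultimately show ?thesis using W'(2) k(1) by metis
qed

lemma nbhd_2I: "u \<in> N v \<Longrightarrow> u \<in> nbhd 2 v"
  and nbhd_2I': "u \<in> N w \<Longrightarrow> w \<in> N v \<Longrightarrow> u \<in> nbhd 2 v"
  using N_sym by (auto simp: numeral_2_eq_2 nbhd_Suc nbhd_0)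

end

section \<open>Embedding a sparse graph\<close>

text \<open>Hall's condition seen from the other side, for subfamilies of at least half of the
  cliques: \<open>T\<close> indexes the cliques left out, \<open>Y\<close> holds target vertices
  left unreached, and a violation has \<open>card T < card Y\<close>. Even a single vertex may form
  \<open>Y\<close>, so there is no slack as in \<open>expands\<close>.\<close>

definition covers :: "(nat set \<Rightarrow> bool) \<Rightarrow> nat \<Rightarrow> nat \<Rightarrow> (nat \<Rightarrow> nat set) \<Rightarrow> bool" where
  "covers X n m q \<longleftrightarrow> (\<forall>Y T. Y \<subseteq> {..<n} - (\<Union>j<m. q j) \<and> T \<subseteq> {..<m} \<and> card T < card Y \<and>
     m \<le> 2 * card ({..<m} - T) \<longrightarrow> hits X q ({..<m} - T) Y)"

context sparse_graph
begin

definition embeds :: "(nat set \<Rightarrow> bool) \<Rightarrow> 'a set \<Rightarrow> ('a \<Rightarrow> nat) \<Rightarrow> bool" where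
  "embeds X S f \<longleftrightarrow> inj_on f S \<and> (\<forall>u\<in>S. \<forall>v\<in>S. u \<in> N v \<longrightarrow> X {f u, f v})"

lemma embeds_Un:
  assumes "embeds X S f" "inj_on g W" "W \<inter> S = {}" "g ` W \<inter> f ` S = {}"
    and "\<And>w. w \<in> W \<Longrightarrow> \<forall>u\<in>f ` (N w \<inter> S). X {u, g w}" "\<And>u v. u \<in> W \<Longrightarrow> v \<in> W \<Longrightarrow> u \<notin> N v"
  shows "embeds X (S \<union> W) (\<lambda>v. if v \<in> W then g v else f v)" (is "embeds X _ ?h")
proof -
  have "inj_on ?h (S \<union> W)"
  proof (rule inj_onI)
    fix u v assume uv: "u \<in> S \<union> W" "v \<in> S \<union> W" "?h u = ?h v"
    have "g a \<noteq> f b" if "a \<in> W" "b \<in> S" for a b using assms(4) that by blast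
    then show "u = v"
      using uv inj_onD[OF assms(2), of u v] assms(1) inj_onD[of f S u v]
      by (auto simp: embeds_def split: if_splits) metis+
  qed
  moreover have "X {?h u, ?h v}" if uv: "u \<in> S \<union> W" "v \<in> S \<union> W" "u \<in> N v" for u v
  proof (cases "v \<in> W")
    case True
    then have "u \<in> S" "u \<notin> W" using uv assms(6) by auto
    then show ?thesis using assms(5)[OF True] True uv by auto
  next
    case vS: False
    show ?thesis
    proof (cases "u \<in> W")
      case True
      then have "X {f v, g u}" using assms(5)[OF True] uv vS N_sym by auto
      then show ?thesis using True vS by (simp add: insert_commute)
    next
      case False
      then show ?thesis using assms(1) vS uv by (auto simp: embeds_def)
    qed
  qed
  ultimately show ?thesis by (simp add: embeds_def)
qed

lemma nbhd_4I: "u \<in> nbhd 2 v \<Longrightarrow> w \<in> nbhd 2 u \<Longrightarrow> w \<in> nbhd 4 v"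
  using relpow_add[of 2 2 "{(u, v). u = v \<or> u \<in> N v}"] by (auto simp: nbhd_def)

end

section \<open>A last layer at pairwise distance at least five\<close>

locale separated = sparse_graph +
  fixes W\<^sub>0 :: "'a set" and k :: nat
  assumes W\<^sub>0_subset: "W\<^sub>0 \<subseteq> V"
    and card_N_W\<^sub>0: "\<And>w. w \<in> W\<^sub>0 \<Longrightarrow> card (N w) = k"
    and far: "\<And>u v. u \<in> W\<^sub>0 \<Longrightarrow> v \<in> W\<^sub>0 \<Longrightarrow> u \<noteq> v \<Longrightarrow> v \<notin> nbhd 4 u"
    and k_le: "k \<le> \<delta>"
begin

definition M :: "'a set" where "M = (\<Union>w\<in>W\<^sub>0. N w)"

lemma finite_W\<^sub>0: "finite W\<^sub>0"
  using W\<^sub>0_subset finite_V finite_subset by blast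

text \<open>Two steps of length two join \<open>w\<close> to \<open>w'\<close> within distance four,
  which \<open>far\<close> forbids for distinct vertices. The separation facts below are
  instances.\<close>

lemma same_center:
  assumes "w \<in> W\<^sub>0" "w' \<in> W\<^sub>0" "u \<in> nbhd 2 w" "w' \<in> nbhd 2 u"
  shows "w = w'"
  using far[OF assms(1,2)] nbhd_4I[OF assms(3,4)] by blast

lemma disjoint_N: "disjoint_family_on N W\<^sub>0"
proof -
  have "w = w'" if "w \<in> W\<^sub>0" "w' \<in> W\<^sub>0" "u \<in> N w" "u \<in> N w'" for u w w'
    by (rule same_center[OF that(1,2) nbhd_refl nbhd_2I'[of w' u w]]) (use that N_sym in auto)
  then show ?thesis by (auto simp: disjoint_family_on_def)
qed

lemma not_adjacent: "u \<in> W\<^sub>0 \<Longrightarrow> v \<in> W\<^sub>0 \<Longrightarrow> u \<notin> N v"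
  using same_center[OF _ _ nbhd_2I nbhd_refl, of v u] N_irrefl by blast

lemma M_disjoint: "M \<inter> W\<^sub>0 = {}" and M_subset: "M \<subseteq> V"
  using not_adjacent N_subset by (auto simp: M_def)

text \<open>Edges inside \<open>M\<close> never join two different neighbourhoods, so cliques on the
  images of the single neighbourhoods supply all of them.\<close>

lemma N_in_M:
  assumes "u \<in> N w" "w \<in> W\<^sub>0" "v \<in> N u" "v \<in> M"
  shows "v \<in> N w"
proof -
  obtain w' where w': "w' \<in> W\<^sub>0" "v \<in> N w'" using assms(4) by (auto simp: M_def)
  have "v \<in> nbhd 2 w" using nbhd_2I'[OF assms(3,1)] .
  moreover have "w' \<in> nbhd 2 v" using w'(2) N_sym by (intro nbhd_2I) blast
  ultimately have "w = w'" by (rule same_center[OF assms(2) w'(1)])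
  then show ?thesis using w' by simp
qed

text \<open>Neighbours of \<open>v\<close> in both \<open>N w\<close> and \<open>N w'\<close> would
  put \<open>w\<close> and \<open>w'\<close> within distance four. So \<open>v\<close> sees only one
  of these neighbourhoods, and that one has \<open>k\<close> elements.\<close>

lemma card_N_M:
  assumes "v \<notin> W\<^sub>0" "v \<notin> M"
  shows "card (N v \<inter> M) \<le> k"
proof (cases "N v \<inter> M = {}")
  case False
  then obtain u w where u: "u \<in> N v" "u \<in> N w" "w \<in> W\<^sub>0" by (auto simp: M_def)
  have "N v \<inter> M \<subseteq> N w"
  proof
    fix u' assume u': "u' \<in> N v \<inter> M"
    then obtain w' where w': "w' \<in> W\<^sub>0" "u' \<in> N w'" by (auto simp: M_def)
    have "v \<in> nbhd 2 w" using u N_sym by (intro nbhd_2I'[of v u w]) auto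
    moreover have "w' \<in> nbhd 2 v" using u' w' N_sym by (intro nbhd_2I'[of w' u' v]) auto
    ultimately have "w = w'" by (rule same_center[OF u(3) w'(1)])
    then show "u' \<in> N w" using w' by simp
  qed
  then have "card (N v \<inter> M) \<le> card (N w)" by (simp add: card_mono finite_N)
  then show ?thesis using card_N_W\<^sub>0 u by simp
qed simp

text \<open>Induction on the number of layers. A layer \<open>W\<close> is peeled off first and
  embedded last, by a Hall matching into an interval behind the one used for \<open>R - W\<close>.
  With \<open>q = (\<delta> + 1) * (\<Delta> + 1)^2\<close>, each layer takes at least the fraction
  \<open>1 / q\<close> of what remains, and the size hypothesis says that \<open>\<tau>\<close>
  layers exhaust \<open>R\<close>.\<close>

lemma embed_rest:
  assumes exp: "\<And>a b. a \<le> b \<Longrightarrow> b \<le> n \<Longrightarrow> expands X n D x ({a..<b} - Q)"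
    and D: "min (2 * \<delta>) \<Delta> \<le> D"
    and f\<^sub>0: "embeds X M f\<^sub>0" "f\<^sub>0 ` M = Q" "Q \<subseteq> {..<n}"
    and "R \<subseteq> V - M - W\<^sub>0"
    and "card R * ((\<delta> + 1) * (\<Delta> + 1)\<^sup>2 - 1) ^ \<tau> < ((\<delta> + 1) * (\<Delta> + 1)\<^sup>2) ^ \<tau>"
    and "card R + \<tau> * x \<le> card ({..<a} - Q)" "a \<le> n"
  shows "\<exists>f. embeds X (M \<union> R) f \<and> (\<forall>v\<in>M. f v = f\<^sub>0 v) \<and> f ` R \<subseteq> {..<a} - Q"
  using assms(6-)
proof (induction \<tau> arbitrary: R a)
  case 0
  have "finite R" using 0(1) finite_V finite_subset by blast
  \<comment> \<open>For \<open>\<tau> = 0\<close> the size hypothesis reads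
    \<open>card R < 1\<close>.\<close>
  then have "R = {}" using 0 by simp
  then show ?case using f\<^sub>0 by (intro exI[of _ f\<^sub>0]) auto
next
  case (Suc \<tau>)
  let ?q = "(\<delta> + 1) * (\<Delta> + 1)\<^sup>2"
  have finR: "finite R" using Suc.prems(1) finite_V finite_subset by blast
  have "R \<subseteq> V" using Suc.prems(1) by blast
  from exists_layer[OF this] obtain W where W: "W \<subseteq> R" "card R \<le> ?q * card W"
    "\<forall>w\<in>W. card (N w \<inter> R) \<le> \<delta>" "\<forall>u\<in>W. \<forall>v\<in>W. u \<noteq> v \<longrightarrow> v \<notin> nbhd 2 u"
    by (elim exE conjE)
  have finW: "finite W" using W(1) finR finite_subset by blast
  let ?R = "R - W"
  have card_R: "card ?R + card W = card R"
    using W(1) finR finW by (metis card_Diff_subset card_mono le_add_diff_inverse2)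
  have "card ?R * ?q \<le> card R * (?q - 1)"
  proof -
    have "card ?R * ?q = card R * ?q - card W * ?q" using card_R
      by (metis add_diff_cancel_right' diff_mult_distrib)
    also have "\<dots> \<le> card R * ?q - card R" using W(2) by (intro diff_le_mono2) (simp add: mult.commute)
    finally show ?thesis by (simp only: diff_mult_distrib2 mult_1_right)
  qed
  then have "card ?R * ?q * (?q - 1) ^ \<tau> \<le> card R * (?q - 1) * (?q - 1) ^ \<tau>" by (rule mult_le_mono1)
  then have "card ?R * (?q - 1) ^ \<tau> * ?q \<le> card R * (?q - 1) ^ Suc \<tau>"
    by (simp only: power_Suc mult_ac)
  also have "\<dots> < ?q ^ Suc \<tau>" by fact
  finally have less: "card ?R * (?q - 1) ^ \<tau> < ?q ^ \<tau>" by (metis mult_less_cancel2 power_Suc2)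
  have "card ?R + \<tau> * x \<le> card ({..<a} - Q)" using Suc.prems(3) card_R by simp
  \<comment> \<open>The prefix up to \<open>b\<close> gets exactly the room that the induction
    hypothesis asks for, so at least \<open>card W + x\<close> free vertices remain between
    \<open>b\<close> and \<open>a\<close>.\<close>
  from exists_prefix_card_Diff[OF this]
  obtain b where b: "b \<le> a" "card ({..<b} - Q) = card ?R + \<tau> * x" by blast
  have "\<exists>f. embeds X (M \<union> ?R) f \<and> (\<forall>v\<in>M. f v = f\<^sub>0 v) \<and> f ` ?R \<subseteq> {..<b} - Q"
    by (rule Suc.IH) (use less b Suc.prems in auto)
  then obtain f where f: "embeds X (M \<union> ?R) f" "\<forall>v\<in>M. f v = f\<^sub>0 v" "f ` ?R \<subseteq> {..<b} - Q" by blast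
  have fM: "f ` M = Q" using f(2) f\<^sub>0(2) by (metis image_cong)
  have inj: "inj_on f (M \<union> ?R)" using f(1) by (simp add: embeds_def)
  let ?I = "{b..<a} - Q" and ?F = "\<lambda>w. f ` (N w \<inter> (M \<union> ?R))"
  have W_nbr: "u \<notin> N v" if "u \<in> W" "v \<in> W" for u v
    using bspec[OF bspec[OF W(4) that(2)] that(1)] nbhd_2I[of u v] N_irrefl[of v] by auto
  have "\<exists>g. inj_on g W \<and> (\<forall>w\<in>W. g w \<in> ?I \<and> (\<forall>u\<in>?F w. X {u, g w}))"
  proof (rule expands_matching[OF exp])
    have "({..<b} - Q) \<union> ?I = {..<a} - Q" using b(1) by auto
    moreover have "card (({..<b} - Q) \<union> ?I) = card ({..<b} - Q) + card ?I"
      by (rule card_Un_disjoint) auto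
    ultimately show "card W + x \<le> card ?I" using b(2) Suc.prems(3) card_R by simp
  next
    fix w assume w: "w \<in> W"
    then have wM: "w \<notin> M" "w \<notin> W\<^sub>0" using W(1) Suc.prems(1) by auto
    have "card (?F w) \<le> card (N w \<inter> (M \<union> ?R))" using finite_N by (intro card_image_le) auto
    moreover have "card (N w \<inter> (M \<union> ?R)) \<le> card (N w)" using finite_N by (intro card_mono) auto
    moreover have "card (N w \<inter> (M \<union> ?R)) \<le> card (N w \<inter> M) + card (N w \<inter> R)"
    proof -
      have "card (N w \<inter> (M \<union> ?R)) \<le> card ((N w \<inter> M) \<union> (N w \<inter> R))"
        using finite_N by (intro card_mono) auto
      then show ?thesis using card_Un_le le_trans by blast
    qed
    \<comment> \<open>At most \<open>k <= \<delta>\<close> embedded neighbours lie in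
      \<open>M\<close> and at most \<open>\<delta>\<close> in \<open>R\<close>, and all of them
      together number at most \<open>\<Delta>\<close>. This is where
      \<open>min (2 * \<delta>) \<Delta>\<close> comes from.\<close>
    ultimately have "card (?F w) \<le> D"
      using D card_N[of w] card_N_M[OF wM(2,1)] bspec[OF W(3) w] k_le by linarith
    moreover have "Q \<subseteq> {..<n} - ?I" "{..<b} - Q \<subseteq> {..<n} - ?I" using f\<^sub>0(3) b(1) Suc.prems(4) by auto
    then have "f ` (M \<union> ?R) \<subseteq> {..<n} - ?I" using fM f(3) unfolding image_Un by blast
    then have "?F w \<subseteq> {..<n} - ?I" by blast
    ultimately show "?F w \<subseteq> {..<n} - ?I \<and> card (?F w) \<le> D" by blast
  next
    show "disjoint_family_on ?F W"
      unfolding disjoint_family_on_def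
    proof (intro ballI impI)
      fix v w assume vw: "v \<in> W" "w \<in> W" "v \<noteq> w"
      \<comment> \<open>Distance at least three excludes common neighbours; injectivity of
        \<open>f\<close> carries disjointness over to the images.\<close>
      have "N v \<inter> N w = {}"
        using bspec[OF bspec[OF W(4) vw(1)] vw(2)] vw(3) nbhd_2I'[of w _ v] N_sym by blast
      then show "?F v \<inter> ?F w = {}" using inj by (auto simp: inj_on_def)
    qed
  qed (use b Suc.prems finW in auto)
  then obtain g where g: "inj_on g W" "\<And>w. w \<in> W \<Longrightarrow> g w \<in> ?I" "\<And>w. w \<in> W \<Longrightarrow> \<forall>u\<in>?F w. X {u, g w}"
    by blast
  let ?f = "\<lambda>v. if v \<in> W then g v else f v"
  have WM: "W \<inter> M = {}" using W(1) Suc.prems(1) by auto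
  have "embeds X ((M \<union> ?R) \<union> W) ?f"
  proof (rule embeds_Un[OF f(1) g(1) _ _ g(3) W_nbr])
    have "g ` W \<subseteq> ?I" using g(2) by blast
    moreover have "?I \<inter> Q = {}" "?I \<inter> ({..<b} - Q) = {}" by auto
    ultimately show "g ` W \<inter> f ` (M \<union> ?R) = {}" using fM f(3) unfolding image_Un by blast
  qed (use WM in auto)
  moreover have eR: "(M \<union> ?R) \<union> W = M \<union> R" using W(1) by auto
  moreover have "?f ` R \<subseteq> {..<a} - Q"
  proof -
    have "?I \<subseteq> {..<a} - Q" "{..<b} - Q \<subseteq> {..<a} - Q" using b(1) by auto
    moreover have "?f v \<in> ?I \<union> ({..<b} - Q)" if "v \<in> R" for v
      using g(2)[of v] f(3) that by (cases "v \<in> W") auto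
    ultimately show ?thesis by blast
  qed
  moreover have "\<forall>v\<in>M. ?f v = f\<^sub>0 v" using f(2) WM by auto
  ultimately show ?case unfolding eR by (intro exI[of _ ?f] conjI)
qed

text \<open>By \<open>N_in_M\<close>, adjacent vertices of \<open>M\<close> share one
  \<open>N w\<close>, whose image is a clique. So the neighbourhoods may be mapped onto the cliques
  by arbitrary bijections.\<close>

lemma embed_neighbourhood:
  assumes "bij_betw e W\<^sub>0 {..<m}" "disjoint_family_on q {..<m}"
    and "\<And>j. j < m \<Longrightarrow> finite (q j) \<and> card (q j) = k"
    and "\<And>j u v. j < m \<Longrightarrow> u \<in> q j \<Longrightarrow> v \<in> q j \<Longrightarrow> u \<noteq> v \<Longrightarrow> X {u, v}"
  shows "\<exists>f. embeds X M f \<and> (\<forall>w\<in>W\<^sub>0. f ` N w = q (e w))"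
proof -
  have e: "e w < m" if "w \<in> W\<^sub>0" for w using assms(1) that by (auto simp: bij_betw_def)
  have "disjoint_family_on (\<lambda>w. q (e w)) W\<^sub>0"
    unfolding disjoint_family_on_def
  proof (intro ballI impI)
    fix v w assume vw: "v \<in> W\<^sub>0" "w \<in> W\<^sub>0" "v \<noteq> w"
    then have "e v \<noteq> e w" using assms(1) by (auto simp: bij_betw_def inj_on_def)
    then show "q (e v) \<inter> q (e w) = {}" using assms(2) e vw by (auto simp: disjoint_family_on_def)
  qed
  from exists_inj_on_blocks[OF disjoint_N this]
  obtain f where f: "inj_on f M" "\<forall>w\<in>W\<^sub>0. f ` N w = q (e w)"
    using assms(3) e finite_N card_N_W\<^sub>0 unfolding M_def by metis
  have "X {f u, f v}" if uv: "u \<in> M" "v \<in> M" "u \<in> N v" for u v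
  proof -
    obtain w where w: "w \<in> W\<^sub>0" "v \<in> N w" using uv by (auto simp: M_def)
    have "u \<in> N w" using N_in_M[OF w(2,1) uv(3,1)] .
    moreover have "f u \<noteq> f v" using f(1) uv N_irrefl by (metis inj_onD)
    ultimately show ?thesis using assms(4)[OF e[OF w(1)]] f(2) w by blast
  qed
  then show ?thesis using f by (auto simp: embeds_def)
qed

text \<open>\<open>M\<close> goes onto the cliques, \<open>?R\<close> into a prefix of the free
  vertices, and \<open>W\<^sub>0\<close> onto the \<open>m\<close> vertices left over. This last
  matching has no surplus, so a set violating Hall's condition is excluded by expansion if it is
  small and by \<open>covers\<close> if it is large.\<close>

lemma exists_embedding:
  assumes exp: "\<And>a b. a \<le> b \<Longrightarrow> b \<le> n \<Longrightarrow> expands X n D x ({a..<b} - (\<Union>j<m. q j))"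
    and cov: "covers X n m q"
    and D: "min (2 * \<delta>) \<Delta> \<le> D"
    and q: "disjoint_family_on q {..<m}" "\<And>j. j < m \<Longrightarrow> q j \<subseteq> {..<n} \<and> card (q j) = k"
    "\<And>j u v. j < m \<Longrightarrow> u \<in> q j \<Longrightarrow> v \<in> q j \<Longrightarrow> u \<noteq> v \<Longrightarrow> X {u, v}"
    and n: "card V = n" "card W\<^sub>0 = m"
    and \<tau>: "n * ((\<delta> + 1) * (\<Delta> + 1)\<^sup>2 - 1) ^ \<tau> < ((\<delta> + 1) * (\<Delta> + 1)\<^sup>2) ^ \<tau>"
    and m: "2 * (\<tau> + 1) * x \<le> m"
  shows "\<exists>f. embeds X V f \<and> f ` V \<subseteq> {..<n}"
proof -
  let ?Q = "\<Union>j<m. q j" and ?R = "V - M - W\<^sub>0"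
  obtain e where e: "bij_betw e W\<^sub>0 {..<m}"
    using ex_bij_betw_finite_nat[OF finite_W\<^sub>0] n(2) by (auto simp: atLeast0LessThan)
  have finq: "finite (q j)" if "j < m" for j using q(2)[OF that] finite_subset by blast
  obtain f\<^sub>0 where f\<^sub>0: "embeds X M f\<^sub>0" "\<forall>w\<in>W\<^sub>0. f\<^sub>0 ` N w = q (e w)"
    using embed_neighbourhood[OF e q(1), of X] q(2,3) finq by blast
  have f\<^sub>0M: "f\<^sub>0 ` M = ?Q"
  proof -
    have "f\<^sub>0 ` M = (\<Union>w\<in>W\<^sub>0. q (e w))" using f\<^sub>0(2) unfolding M_def image_UN by simp
    also have "\<dots> = (\<Union>j\<in>e ` W\<^sub>0. q j)" by simp
    finally show ?thesis unfolding bij_betw_imp_surj_on[OF e] .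
  qed
  have Qn: "?Q \<subseteq> {..<n}" using q(2) by blast
  have finM: "finite M" using M_subset finite_V finite_subset by blast
  have cardQ: "card ?Q = card M" using f\<^sub>0(1) card_image[of f\<^sub>0 M] f\<^sub>0M by (simp add: embeds_def)
  have cardR: "card ?R + card M + m = n"
  proof -
    have "card ?R = card (V - M) - card W\<^sub>0"
      using W\<^sub>0_subset M_disjoint finite_W\<^sub>0 by (intro card_Diff_subset) auto
    moreover have "card (V - M) = n - card M" using M_subset finM n(1) by (simp add: card_Diff_subset)
    moreover have "card (M \<union> W\<^sub>0) \<le> n" using M_subset W\<^sub>0_subset finite_V n(1) by (metis card_mono Un_subset_iff)
    moreover have "card (M \<union> W\<^sub>0) = card M + m" using M_disjoint finM finite_W\<^sub>0 n(2) by (simp add: card_Un_disjoint)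
    ultimately show ?thesis using n(2) by simp
  qed
  have cardnQ: "card ({..<n} - ?Q) = card ?R + m"
    using Qn cardQ cardR by (simp add: card_Diff_subset finite_subset)
  then have "card ?R + \<tau> * x \<le> card ({..<n} - ?Q)" using m by (simp add: algebra_simps)
  from exists_prefix_card_Diff[OF this]
  obtain a where a: "a \<le> n" "card ({..<a} - ?Q) = card ?R + \<tau> * x" by blast
  have "\<exists>f. embeds X (M \<union> ?R) f \<and> (\<forall>v\<in>M. f v = f\<^sub>0 v) \<and> f ` ?R \<subseteq> {..<a} - ?Q"
  proof (rule embed_rest[OF exp D f\<^sub>0(1) f\<^sub>0M Qn])
    have "card ?R \<le> n" using cardR by simp
    then show "card ?R * ((\<delta> + 1) * (\<Delta> + 1)\<^sup>2 - 1) ^ \<tau> < ((\<delta> + 1) * (\<Delta> + 1)\<^sup>2) ^ \<tau>"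
      using \<tau> by (meson le_less_trans mult_le_mono1)
  qed (use a in auto)
  then obtain f where f: "embeds X (M \<union> ?R) f" "\<forall>v\<in>M. f v = f\<^sub>0 v" "f ` ?R \<subseteq> {..<a} - ?Q" by blast
  have fN: "f ` N w = q (e w)" if "w \<in> W\<^sub>0" for w
  proof -
    have "f ` N w = f\<^sub>0 ` N w" using f(2) that by (intro image_cong) (auto simp: M_def)
    then show ?thesis using f\<^sub>0(2) that by simp
  qed
  have fM: "f ` M = ?Q" using f(2) f\<^sub>0M by (metis image_cong)
  let ?U = "{..<n} - f ` (M \<union> ?R)" and ?I = "{a..<n} - ?Q"
  have fsub: "f ` (M \<union> ?R) \<subseteq> {..<n}" using fM Qn f(3) a(1) by (fastforce simp: image_Un)
  have finV': "finite (M \<union> ?R)" using finM finite_V by simp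
  have cardU: "card ?U = m"
  proof -
    have "card (f ` (M \<union> ?R)) = card (M \<union> ?R)" using f(1) by (simp add: embeds_def card_image)
    also have "\<dots> = card M + card ?R" using finM finite_V by (intro card_Un_disjoint) auto
    finally show ?thesis using fsub finV' cardR by (subst card_Diff_subset) auto
  qed
  have IU: "?I \<subseteq> ?U" using fM f(3) by (fastforce simp: image_Un)
  have cardI: "card ?I = m - \<tau> * x"
  proof -
    have "({..<a} - ?Q) \<union> ?I = {..<n} - ?Q" using a(1) by auto
    moreover have "card (({..<a} - ?Q) \<union> ?I) = card ({..<a} - ?Q) + card ?I"
      by (rule card_Un_disjoint) auto
    ultimately show ?thesis using a(2) cardnQ by simp
  qed
  define A where "A w = {v \<in> ?U. \<forall>u\<in>f ` N w. X {u, v}}" for w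
  have "\<exists>g. inj_on g W\<^sub>0 \<and> (\<forall>w\<in>W\<^sub>0. g w \<in> A w)"
  proof (rule hall_marriage)
    fix J assume J: "J \<subseteq> W\<^sub>0"
    show "card J \<le> card (\<Union> (A ` J))"
    proof (rule ccontr)
      let ?Z = "\<Union> (A ` J)"
      assume "\<not> ?thesis"
      then have neg: "card ?Z < card J" by simp
      have finJ: "finite J" using J finite_W\<^sub>0 finite_subset by blast
      have cJ: "card J \<le> m" using J finite_W\<^sub>0 n(2) by (metis card_mono)
      have ZU: "?Z \<subseteq> ?U" by (auto simp: A_def)
      have finZ: "finite ?Z" using ZU finite_subset by blast
      have eJ: "e w < m" if "w \<in> J" for w using e J that by (auto simp: bij_betw_def)
      show False
      proof (cases "2 * card J \<le> m")
        case True
        have "hits X (\<lambda>w. f ` N w) J (?I - ?Z \<inter> ?I)"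
        proof (rule expands_hits[OF exp finJ])
          have "card (?Z \<inter> ?I) \<le> card ?Z" using finZ by (intro card_mono) auto
          then show "card (?Z \<inter> ?I) < card J" using neg by simp
          then have "card ?I - card J \<le> card (?I - ?Z \<inter> ?I)"
            by (subst card_Diff_subset) auto
          \<comment> \<open>At most \<open>m / 2\<close> of the \<open>m - \<tau> * x\<close>
            vertices of \<open>?I\<close> are reached, and
            \<open>m / 2 >= (\<tau> + 1) * x\<close>.\<close>
          then show "x \<le> card (?I - ?Z \<inter> ?I)" using cardI True m by (simp add: algebra_simps)
          show "card J \<le> n" using cJ cardR by simp
          have "disjoint_family_on N J" using disjoint_N J by (meson disjoint_family_on_mono)
          moreover have "inj_on f M" using f(1) by (auto simp: embeds_def inj_on_Un)
          moreover have "N w \<subseteq> M" if "w \<in> J" for w using that J by (auto simp: M_def)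
          ultimately show "disjoint_family_on (\<lambda>w. f ` N w) J"
            unfolding disjoint_family_on_def by (metis image_empty inj_on_image_Int)
        next
          fix j assume j: "j \<in> J"
          have "k \<le> D" using D k_le \<delta>_le by linarith
          then show "f ` N j \<subseteq> {..<n} - ?I \<and> card (f ` N j) \<le> D"
            using fN[of j] j J q(2)[OF eJ[OF j]] eJ[OF j] by auto
        qed (use a neg in auto)
        then show False using IU by (auto simp: hits_def A_def)
      next
        case False
        \<comment> \<open>\<open>?T\<close> indexes the cliques of the vertices outside
          \<open>J\<close>. There are \<open>m - card J\<close> of them, fewer than the
          \<open>m - card ?Z\<close> unreached vertices.\<close>
        let ?T = "{..<m} - e ` J"
        have eJm: "e ` J \<subseteq> {..<m}" using eJ by auto
        have T: "{..<m} - ?T = e ` J" using eJm by auto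
        have ce: "card (e ` J) = card J" using e J by (metis bij_betw_def card_image inj_on_subset)
        have "card (?U - ?Z) = m - card ?Z" using ZU finZ cardU by (simp add: card_Diff_subset)
        moreover have "card ?T = m - card J" using eJm ce finJ by (simp add: card_Diff_subset)
        ultimately have "card ?T < card (?U - ?Z)" using neg cJ by linarith
        moreover have "m \<le> 2 * card ({..<m} - ?T)" unfolding T ce using False by simp
        moreover have "?U - ?Z \<subseteq> {..<n} - ?Q" using fM by auto
        ultimately have "hits X q ({..<m} - ?T) (?U - ?Z)"
          using cov[unfolded covers_def, rule_format, of "?U - ?Z" ?T] by simp
        then obtain w v where w: "w \<in> J" "v \<in> ?U - ?Z" "\<forall>u\<in>q (e w). X {u, v}"
          unfolding T hits_def by blast
        then have "v \<in> A w" using fN[of w] J by (auto simp: A_def)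
        then show False using w by blast
      qed
    qed
  qed (use finite_W\<^sub>0 in \<open>auto simp: A_def\<close>)
  then obtain g where g: "inj_on g W\<^sub>0" "\<And>w. w \<in> W\<^sub>0 \<Longrightarrow> g w \<in> A w" by blast
  let ?f = "\<lambda>v. if v \<in> W\<^sub>0 then g v else f v"
  have gU: "g ` W\<^sub>0 \<subseteq> ?U" using g(2) by (auto simp: A_def)
  have eV: "(M \<union> ?R) \<union> W\<^sub>0 = V" using W\<^sub>0_subset M_subset by auto
  have "embeds X ((M \<union> ?R) \<union> W\<^sub>0) ?f"
  proof (rule embeds_Un[OF f(1) g(1)])
    fix w assume "w \<in> W\<^sub>0"
    then show "\<forall>u\<in>f ` (N w \<inter> (M \<union> ?R)). X {u, g w}" using g(2)[of w] by (auto simp: A_def)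
  qed (use M_disjoint gU not_adjacent in auto)
  then have "embeds X V ?f" unfolding eV .
  moreover have "?f ` V \<subseteq> {..<n}"
  proof
    fix y assume "y \<in> ?f ` V"
    then obtain v where v: "v \<in> V" "y = ?f v" by blast
    show "y \<in> {..<n}"
    proof (cases "v \<in> W\<^sub>0")
      case True
      then show ?thesis using v gU by auto
    next
      case False
      then have "v \<in> M \<union> ?R" using v by blast
      then show ?thesis using False v fsub by auto
    qed
  qed
  ultimately show ?thesis by (intro exI[of _ ?f] conjI)
qed

end

section \<open>Random graphs\<close>

lemma prob_pair_pmf_Times:
  "measure_pmf.prob (pair_pmf M N) (A \<times> B) = measure_pmf.prob M A * measure_pmf.prob N B"
proof -
  have "measure_pmf.prob (pair_pmf M N) (A \<times> B) =
      measure_pmf.prob (pair_pmf M N) ((A \<inter> set_pmf M) \<times> (B \<inter> set_pmf N))"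
    by (subst measure_Int_set_pmf[symmetric]) (simp add: Times_Int_Times)
  also have "\<dots> = measure_pmf.prob M (A \<inter> set_pmf M) * measure_pmf.prob N (B \<inter> set_pmf N)"
    by (rule measure_pmf_prob_product) auto
  finally show ?thesis by (simp add: measure_Int_set_pmf)
qed

text \<open>Condition on the first coordinate: the inner probability is at most one outside
  \<open>G\<close> and at most \<open>c\<close> inside. Objects depending on the first random graph
  can thus be fixed before the second one is drawn.\<close>

lemma prob_pair_pmf_le:
  assumes "\<And>x. x \<in> G \<Longrightarrow> measure_pmf.prob N {y. (x, y) \<in> B} \<le> c" "0 \<le> c"
  shows "measure_pmf.prob (pair_pmf M N) B \<le> measure_pmf.prob M (- G) + c"
proof -
  have "emeasure (pair_pmf M N) B = (\<integral>\<^sup>+z. indicator B z \<partial>pair_pmf M N)" by simp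
  also have "\<dots> = (\<integral>\<^sup>+x. (\<integral>\<^sup>+y. indicator B (x, y) \<partial>N) \<partial>M)" by (rule nn_integral_pair_pmf')
  also have "\<dots> = (\<integral>\<^sup>+x. emeasure N {y. (x, y) \<in> B} \<partial>M)"
  proof (rule nn_integral_cong)
    fix x
    have "(\<integral>\<^sup>+y. indicator B (x, y) \<partial>N) = (\<integral>\<^sup>+y. indicator {y. (x, y) \<in> B} y \<partial>N)"
      by (intro nn_integral_cong) (simp add: indicator_def)
    then show "(\<integral>\<^sup>+y. indicator B (x, y) \<partial>N) = emeasure N {y. (x, y) \<in> B}" by simp
  qed
  also have "\<dots> \<le> (\<integral>\<^sup>+x. indicator (- G) x + ennreal c \<partial>M)"
  proof (rule nn_integral_mono)
    fix x
    show "emeasure N {y. (x, y) \<in> B} \<le> indicator (- G) x + ennreal c"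
    proof (cases "x \<in> G")
      case True
      then show ?thesis using assms by (simp add: measure_pmf.emeasure_eq_measure ennreal_leI)
    next
      case False
      then have "emeasure N {y. (x, y) \<in> B} \<le> indicator (- G) x"
        by (simp add: measure_pmf.emeasure_eq_measure)
      then show ?thesis by (simp add: add_increasing2)
    qed
  qed
  also have "\<dots> = emeasure M (- G) + ennreal c"
    by (simp add: nn_integral_add)
  finally have "ennreal (measure_pmf.prob (pair_pmf M N) B) \<le> ennreal (measure_pmf.prob M (- G) + c)"
    using assms(2) by (simp add: measure_pmf.emeasure_eq_measure)
  then show ?thesis using assms(2) by (simp add: ennreal_le_iff del: ennreal_plus)
qed

lemma prob_UN_le:
  assumes "finite K" "\<And>k. k \<in> K \<Longrightarrow> measure_pmf.prob M (A k) \<le> c"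
  shows "measure_pmf.prob M (\<Union>k\<in>K. A k) \<le> real (card K) * c"
proof -
  have "measure_pmf.prob M (\<Union>k\<in>K. A k) \<le> (\<Sum>k\<in>K. measure_pmf.prob M (A k))"
    using assms(1) by (intro measure_pmf.finite_measure_subadditive_finite) auto
  also have "\<dots> \<le> real (card K) * c" using assms(2) by (rule sum_bounded_above)
  finally show ?thesis .
qed

lemma bernoulli_pmf_disj:
  assumes "0 \<le> p" "p \<le> 1"
  shows "bernoulli_pmf (1 - (1 - p)\<^sup>2) =
    map_pmf (\<lambda>(a, b). a \<or> b) (pair_pmf (bernoulli_pmf p) (bernoulli_pmf p))" (is "?L = ?R")
proof -
  have le: "(1 - p)\<^sup>2 \<le> 1" using assms by (simp add: power_le_one)
  have "pmf ?R False = measure_pmf.prob (pair_pmf (bernoulli_pmf p) (bernoulli_pmf p)) {(False, False)}"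
    unfolding pmf_map by (intro arg_cong2[of _ _ _ _ measure]) auto
  also have "\<dots> = (1 - p)\<^sup>2"
    using assms by (simp add: measure_pmf_single pmf_pair power2_eq_square)
  finally have F: "pmf ?L False = pmf ?R False" using le assms by simp
  show ?thesis
  proof (rule pmf_eqI)
    fix b show "pmf ?L b = pmf ?R b"
      using F pmf_False_conv_True[of ?L] pmf_False_conv_True[of ?R] by (cases b) auto
  qed
qed

text \<open>Coordinatewise, an edge is absent from the union exactly if both rounds miss it. The
  induction step commutes the second coin of the new element past the first sample on the
  rest.\<close>

lemma Pi_pmf_bernoulli_disj:
  assumes "finite A" "0 \<le> p" "p \<le> 1"
  shows "Pi_pmf A False (\<lambda>_. bernoulli_pmf (1 - (1 - p)\<^sup>2)) = map_pmf (\<lambda>(X, Y) e. X e \<or> Y e)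
    (pair_pmf (Pi_pmf A False (\<lambda>_. bernoulli_pmf p)) (Pi_pmf A False (\<lambda>_. bernoulli_pmf p)))"
  using assms(1)
proof (induction A rule: finite_induct)
  case (insert e A)
  let ?b = "bernoulli_pmf p" and ?P = "Pi_pmf A False (\<lambda>_. bernoulli_pmf p)"
  have "Pi_pmf (insert e A) False (\<lambda>_. bernoulli_pmf (1 - (1 - p)\<^sup>2)) =
      do {a \<leftarrow> ?b; b \<leftarrow> ?b; X \<leftarrow> ?P; Y \<leftarrow> ?P; return_pmf ((\<lambda>z. X z \<or> Y z)(e := a \<or> b))}"
    using insert by (simp add: Pi_pmf_insert' bernoulli_pmf_disj[OF assms(2,3)] map_pmf_def pair_pmf_def
        bind_assoc_pmf bind_return_pmf)
  also have "\<dots> = do {a \<leftarrow> ?b; X \<leftarrow> ?P; b \<leftarrow> ?b; Y \<leftarrow> ?P; return_pmf ((\<lambda>z. X z \<or> Y z)(e := a \<or> b))}"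
    by (subst bind_commute_pmf) simp
  also have "\<dots> = do {a \<leftarrow> ?b; X \<leftarrow> ?P; b \<leftarrow> ?b; Y \<leftarrow> ?P;
      return_pmf (\<lambda>z. (X(e := a)) z \<or> (Y(e := b)) z)}"
    by (intro bind_pmf_cong refl arg_cong[of _ _ return_pmf]) auto
  finally show ?case
    using insert by (simp add: Pi_pmf_insert' map_pmf_def pair_pmf_def bind_assoc_pmf bind_return_pmf)
qed (simp add: pair_return_pmf)

text \<open>Disjoint blocks depend on disjoint coordinates. Splitting the product into the
  coordinates of one block and all others turns the event into a rectangle.\<close>

lemma prob_no_full_block:
  fixes B :: "'a \<Rightarrow> 'b set"
  assumes "finite T" "finite A" "\<And>t. t \<in> T \<Longrightarrow> B t \<subseteq> A" "disjoint_family_on B T" "0 \<le> p" "p \<le> 1"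
  shows "measure_pmf.prob (Pi_pmf A False (\<lambda>_. bernoulli_pmf p)) {X. \<forall>t\<in>T. \<exists>e\<in>B t. \<not> X e} =
    (\<Prod>t\<in>T. 1 - p ^ card (B t))"
  using assms(1-4)
proof (induction T arbitrary: A rule: finite_induct)
  case empty
  then show ?case by simp
next
  case (insert t T)
  let ?P = "\<lambda>A. Pi_pmf A False (\<lambda>_. bernoulli_pmf p)"
  have fin: "finite (B t)" using insert.prems finite_subset by blast
  have dj: "B t \<inter> B s = {}" if "s \<in> T" for s
    using insert that by (auto simp: disjoint_family_on_def)
  have A: "B t \<union> (A - B t) = A" using insert.prems by auto
  have pP: "?P A = map_pmf (\<lambda>(f, g) x. if x \<in> B t then f x else g x) (pair_pmf (?P (B t)) (?P (A - B t)))"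
    using Pi_pmf_union[of "B t" "A - B t" False "\<lambda>_. bernoulli_pmf p"] fin insert.prems(1)
    unfolding A by auto
  let ?h = "\<lambda>(f, g) x. if x \<in> B t then f x else g x"
  have pre: "?h -` {X. \<forall>t\<in>insert t T. \<exists>e\<in>B t. \<not> X e} =
      {X. \<exists>e\<in>B t. \<not> X e} \<times> {X. \<forall>t\<in>T. \<exists>e\<in>B t. \<not> X e}"
  proof (rule set_eqI, rule prod.induct)
    fix f g :: "'b \<Rightarrow> bool"
    have "(\<exists>e\<in>B s. \<not> ?h (f, g) e) = (\<exists>e\<in>B s. \<not> g e)" if "s \<in> T" for s
      using dj[OF that] by (intro bex_cong) auto
    moreover have "(\<exists>e\<in>B t. \<not> ?h (f, g) e) = (\<exists>e\<in>B t. \<not> f e)" by (intro bex_cong) auto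
    ultimately show "((f, g) \<in> ?h -` {X. \<forall>t\<in>insert t T. \<exists>e\<in>B t. \<not> X e}) =
        ((f, g) \<in> {X. \<exists>e\<in>B t. \<not> X e} \<times> {X. \<forall>t\<in>T. \<exists>e\<in>B t. \<not> X e})"
      unfolding vimage_eq mem_Collect_eq mem_Sigma_iff ball_simps by simp
  qed
  have "measure_pmf.prob (?P A) {X. \<forall>t\<in>insert t T. \<exists>e\<in>B t. \<not> X e} =
      measure_pmf.prob (pair_pmf (?P (B t)) (?P (A - B t)))
        ({X. \<exists>e\<in>B t. \<not> X e} \<times> {X. \<forall>t\<in>T. \<exists>e\<in>B t. \<not> X e})"
    unfolding pP measure_map_pmf pre ..
  also have "\<dots> = measure_pmf.prob (?P (B t)) {X. \<exists>e\<in>B t. \<not> X e} *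
      measure_pmf.prob (?P (A - B t)) {X. \<forall>t\<in>T. \<exists>e\<in>B t. \<not> X e}"
    by (rule prob_pair_pmf_Times)
  also have "measure_pmf.prob (?P (B t)) {X. \<exists>e\<in>B t. \<not> X e} = 1 - p ^ card (B t)"
  proof -
    have "{X. \<exists>e\<in>B t. \<not> X e} = UNIV - Pi (B t) (\<lambda>_. {True})" by auto
    then have "measure_pmf.prob (?P (B t)) {X. \<exists>e\<in>B t. \<not> X e} =
        1 - measure_pmf.prob (?P (B t)) (Pi (B t) (\<lambda>_. {True}))"
      using measure_pmf.prob_compl[of "Pi (B t) (\<lambda>_. {True})" "?P (B t)"] by simp
    then show ?thesis
      using fin assms(5,6) by (simp add: measure_Pi_pmf_Pi measure_pmf_single)
  qed
  also have "measure_pmf.prob (?P (A - B t)) {X. \<forall>t\<in>T. \<exists>e\<in>B t. \<not> X e} = (\<Prod>t\<in>T. 1 - p ^ card (B t))"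
  proof (rule insert.IH)
    show "disjoint_family_on B T" using insert.prems by (auto simp: disjoint_family_on_def)
    show "B s \<subseteq> A - B t" if "s \<in> T" for s using insert.prems(2)[of s] dj[OF that] that by auto
  qed (use insert.prems in auto)
  finally show ?case using insert by simp
qed

section \<open>Union bounds for expansion and covering\<close>

definition pairs_pmf :: "nat \<Rightarrow> real \<Rightarrow> (nat set \<Rightarrow> bool) pmf" where
  "pairs_pmf n p = Pi_pmf (vertex_pairs {..<n}) False (\<lambda>_. bernoulli_pmf p)"

lemma finite_vertex_pairs: "finite A \<Longrightarrow> finite (vertex_pairs A)"
  by (simp add: vertex_pairs_def)

text \<open>Each \<open>j\<close> and \<open>v\<close> ask for the star from \<open>v\<close> to
  \<open>F j\<close>. The stars are edge-disjoint, since the sets \<open>F j\<close> are disjoint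
  and lie outside \<open>Y\<close>, so their absences are independent, each of probability at most
  \<open>1 - p ^ D <= exp (- (p ^ D))\<close>.\<close>

lemma prob_not_hits:
  assumes "finite S" "Y \<subseteq> {..<n}" "\<And>j. j \<in> S \<Longrightarrow> F j \<subseteq> {..<n} - Y \<and> card (F j) \<le> D"
    and "disjoint_family_on F S" "0 \<le> p" "p \<le> 1" "s \<le> card S" "y \<le> card Y"
  shows "measure_pmf.prob (pairs_pmf n p) {X. \<not> hits X F S Y} \<le> exp (- (p ^ D * s * y))"
proof -
  define B where "B = (\<lambda>(j, v). (\<lambda>u. {u, v}) ` F j)"
  have finY: "finite Y" using assms(2) finite_subset by blast
  have inj: "inj_on (\<lambda>u. {u, v}) (F j)" for j v by (auto simp: inj_on_def doubleton_eq_iff)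
  have "{X. \<not> hits X F S Y} = {X. \<forall>t\<in>S \<times> Y. \<exists>e\<in>B t. \<not> X e}" by (auto simp: hits_def B_def)
  also have "measure_pmf.prob (pairs_pmf n p) \<dots> = (\<Prod>t\<in>S \<times> Y. 1 - p ^ card (B t))"
    unfolding pairs_pmf_def
  proof (rule prob_no_full_block)
    fix t assume "t \<in> S \<times> Y"
    then obtain j v where t: "t = (j, v)" "j \<in> S" "v \<in> Y" by auto
    have "{u, v} \<in> vertex_pairs {..<n}" if "u \<in> F j" for u
      using assms(2) assms(3)[OF t(2)] t that by (auto simp: vertex_pairs_def card_insert_if)
    then show "B t \<subseteq> vertex_pairs {..<n}" by (auto simp: B_def t(1))
  next
    show "disjoint_family_on B (S \<times> Y)"
      unfolding disjoint_family_on_def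
    proof (intro ballI impI)
      fix t t' assume tt: "t \<in> S \<times> Y" "t' \<in> S \<times> Y" "t \<noteq> t'"
      obtain j v j' v' where jv: "t = (j, v)" "j \<in> S" "v \<in> Y" "t' = (j', v')" "j' \<in> S" "v' \<in> Y"
        using tt by auto
      have False if u: "u \<in> F j" "u' \<in> F j'" "{u, v} = {u', v'}" for u u'
      proof -
        have "u \<noteq> v'" "u' \<noteq> v" using assms(3)[OF jv(2)] assms(3)[OF jv(5)] jv u by auto
        then have "u = u'" "v = v'" using u(3) by (auto simp: doubleton_eq_iff)
        moreover have "j = j'" using assms(4) u jv \<open>u = u'\<close> by (auto simp: disjoint_family_on_def)
        ultimately show False using tt jv by simp
      qed
      then show "B t \<inter> B t' = {}" by (auto simp: B_def jv(1,4))
    qed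
  qed (use assms finY in \<open>auto intro: finite_vertex_pairs\<close>)
  also have "\<dots> \<le> (\<Prod>t\<in>S \<times> Y. exp (- (p ^ D)))"
  proof (rule prod_mono)
    fix t assume "t \<in> S \<times> Y"
    then obtain j v where t: "t = (j, v)" "j \<in> S" "v \<in> Y" by auto
    have "card (B t) \<le> D" using assms(3)[OF t(2)] inj[of v j] by (simp add: B_def t(1) card_image)
    then have "p ^ D \<le> p ^ card (B t)" using assms by (simp add: power_decreasing)
    moreover have "1 - p ^ D \<le> exp (- (p ^ D))" using exp_ge_add_one_self[of "- (p ^ D)"] by simp
    moreover have "p ^ card (B t) \<le> 1" using assms by (simp add: power_le_one)
    ultimately show "0 \<le> 1 - p ^ card (B t) \<and> 1 - p ^ card (B t) \<le> exp (- (p ^ D))" by linarith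
  qed
  also have "\<dots> = exp (- (p ^ D * (card S * card Y)))"
    by (simp add: card_cartesian_product exp_of_nat_mult[symmetric] mult.commute)
  also have "\<dots> \<le> exp (- (p ^ D * s * y))"
  proof -
    have "real s * real y \<le> real (card S) * real (card Y)" using assms(7,8) by (intro mult_mono) auto
    then have "p ^ D * (real s * real y) \<le> p ^ D * (real (card S) * real (card Y))"
      using assms(5) by (intro mult_left_mono) auto
    then show ?thesis by (simp add: mult.assoc)
  qed
  finally show ?thesis .
qed

definition small_subsets :: "nat \<Rightarrow> nat \<Rightarrow> nat set set" where
  "small_subsets n D = {A. A \<subseteq> {..<n} \<and> card A \<le> D}"

lemma finite_small_subsets: "finite (small_subsets n D)"
  by (rule finite_subset[of _ "Pow {..<n}"]) (auto simp: small_subsets_def)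

lemma card_small_subsets: "card (small_subsets n D) \<le> (n + 1) ^ D"
proof (induction D)
  case 0
  have "small_subsets n 0 \<subseteq> {{}}" using finite_subset by (fastforce simp: small_subsets_def)
  then show ?case using card_mono[of "{{}}" "small_subsets n 0"] by simp
next
  case (Suc D)
  \<comment> \<open>The symbol \<open>n\<close> stands for adding no vertex, so a set of at most
    \<open>Suc D\<close> vertices is encoded by a smaller set and one of \<open>n + 1\<close>
    symbols.\<close>
  let ?h = "\<lambda>(A, u). if u = n then A else insert u A"
  have "small_subsets n (Suc D) \<subseteq> ?h ` (small_subsets n D \<times> {..n})"
  proof
    fix A assume A: "A \<in> small_subsets n (Suc D)"
    show "A \<in> ?h ` (small_subsets n D \<times> {..n})"
    proof (cases "A = {}")
      case True
      then show ?thesis by (intro image_eqI[of _ _ "({}, n)"]) (auto simp: small_subsets_def)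
    next
      case False
      then obtain u where u: "u \<in> A" by blast
      have "finite A" using A finite_subset by (auto simp: small_subsets_def)
      then have "A - {u} \<in> small_subsets n D" using A u by (auto simp: small_subsets_def)
      moreover have "u < n" using A u by (auto simp: small_subsets_def)
      ultimately show ?thesis using u by (intro image_eqI[of _ _ "(A - {u}, u)"]) auto
    qed
  qed
  then have "card (small_subsets n (Suc D)) \<le> card (?h ` (small_subsets n D \<times> {..n}))"
    by (intro card_mono) (auto intro: finite_small_subsets)
  also have "\<dots> \<le> card (small_subsets n D \<times> {..n})"
    by (intro card_image_le) (auto intro: finite_small_subsets)
  also have "\<dots> = card (small_subsets n D) * (n + 1)" by (simp add: card_cartesian_product)
  also have "\<dots> \<le> (n + 1) ^ D * (n + 1)" using Suc by (rule mult_le_mono1)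
  also have "\<dots> = (n + 1) ^ Suc D" by (simp only: power_Suc2)
  finally show ?case .
qed

text \<open>The first hypothesis pushes the exponential below the power of \<open>n + 1\<close> with
  exponent \<open>- (D + 6) * s\<close>. This beats \<open>(n + 1) ^ a\<close> and leaves three
  powers to spare.\<close>

lemma union_bound_le:
  fixes p :: real and s x D n a :: nat
  assumes "real (D + 6) * ln (real n + 1) \<le> p ^ D * real x" "1 \<le> s" "a + 3 \<le> (D + 6) * s" "K \<le> (n + 1) ^ a"
  shows "real K * exp (- (p ^ D * real s * real x)) \<le> 1 / (real n + 1) ^ 3"
proof -
  let ?k = "(D + 6) * s"
  have "real ?k * ln (real n + 1) \<le> p ^ D * real s * real x"
    using mult_right_mono[OF assms(1), of "real s"] by (simp add: mult_ac del: of_nat_add)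
  then have "exp (- (p ^ D * real s * real x)) \<le> exp (- (real ?k * ln (real n + 1)))" by simp
  also have "\<dots> = 1 / exp (real ?k * ln (real n + 1))" by (simp only: exp_minus inverse_eq_divide)
  also have "exp (real ?k * ln (real n + 1)) = (real n + 1) ^ ?k" by (subst exp_of_nat_mult) simp
  also have "1 / (real n + 1) ^ ?k \<le> 1 / (real n + 1) ^ (a + 3)"
    using assms(3) by (intro divide_left_mono power_increasing) auto
  finally have "real K * exp (- (p ^ D * real s * real x)) \<le> real ((n + 1) ^ a) * (1 / (real n + 1) ^ (a + 3))"
    using assms(4) by (intro mult_mono) (auto simp del: of_nat_power)
  also have "\<dots> = 1 / (real n + 1) ^ 3" by (simp add: power_add add.commute)
  finally show ?thesis .
qed

lemma n_over_cube: "real n * (1 / (real n + 1) ^ 3) \<le> 1 / (real n + 1)\<^sup>2"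
proof -
  have "real n * (1 / (real n + 1) ^ 3) \<le> (real n + 1) * (1 / (real n + 1) ^ 3)"
    by (intro mult_right_mono) auto
  also have "\<dots> = 1 / (real n + 1)\<^sup>2" by (simp add: power3_eq_cube power2_eq_square)
  finally show ?thesis .
qed

text \<open>For each \<open>s\<close>, the interval ends, \<open>F\<close> and \<open>Z\<close>
  allow at most \<open>(n + 1) ^ (2 + D * s + s)\<close> choices. Adding the three spare powers
  gives an exponent of at most \<open>(D + 6) * s\<close>, which explains the 6.\<close>

lemma prob_not_expands:
  assumes "0 \<le> p" "p \<le> 1" "real (D + 6) * ln (real n + 1) \<le> p ^ D * real x"
  shows "measure_pmf.prob (pairs_pmf n p) {X. \<exists>a b. a \<le> b \<and> b \<le> n \<and> \<not> expands X n D x ({a..<b} - Q)}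
    \<le> 1 / (real n + 1)\<^sup>2"
proof -
  define I where "I a b = {a..<b} - Q" for a b
  define K where "K s = {(a, b, F, Z). a \<le> n \<and> b \<le> n \<and> F \<in> {..<s} \<rightarrow>\<^sub>E small_subsets n D \<and> Z \<in> small_subsets n s \<and>
    (\<forall>j<s. F j \<subseteq> {..<n} - I a b) \<and> disjoint_family_on F {..<s} \<and> x \<le> card (I a b - Z)}" for s
  define bad where "bad s = (\<lambda>(a, b, F, Z). {X. \<not> hits X F {..<s} (I a b - Z)})" for s :: nat
  let ?K = "\<lambda>s. {..n} \<times> {..n} \<times> ({..<s} \<rightarrow>\<^sub>E small_subsets n D) \<times> small_subsets n s"
  have sub: "K s \<subseteq> ?K s" for s by (auto simp: K_def)
  have fin: "finite (?K s)" for s by (intro finite_cartesian_product finite_PiE finite_small_subsets) auto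
  have cardK: "card (K s) \<le> (n + 1) ^ (2 + D * s + s)" for s
  proof -
    have "card (K s) \<le> card (?K s)" by (intro card_mono fin sub)
    also have "\<dots> = (n + 1) * ((n + 1) * (card (small_subsets n D) ^ s * card (small_subsets n s)))"
      by (simp add: card_cartesian_product card_PiE)
    also have "\<dots> \<le> (n + 1) * ((n + 1) * (((n + 1) ^ D) ^ s * (n + 1) ^ s))"
      by (intro mult_le_mono2 mult_le_mono power_mono card_small_subsets) auto
    also have "\<dots> = (n + 1) ^ (2 + D * s + s)" by (simp add: power_add power_mult)
    finally show ?thesis .
  qed
  have bad_le: "measure_pmf.prob (pairs_pmf n p) (\<Union>t\<in>K s. bad s t) \<le> 1 / (real n + 1) ^ 3" if "1 \<le> s" for s
  proof -
    have "measure_pmf.prob (pairs_pmf n p) (\<Union>t\<in>K s. bad s t) \<le> real (card (K s)) * exp (- (p ^ D * s * x))"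
    proof (rule prob_UN_le)
      show "finite (K s)" using finite_subset[OF sub fin] .
      fix t assume "t \<in> K s"
      then obtain a b F Z where t: "t = (a, b, F, Z)" "a \<le> n" "b \<le> n" "F \<in> {..<s} \<rightarrow>\<^sub>E small_subsets n D"
        "\<forall>j<s. F j \<subseteq> {..<n} - I a b" "disjoint_family_on F {..<s}" "x \<le> card (I a b - Z)"
        by (auto simp: K_def)
      have "I a b \<subseteq> {..<n}" using t(3) by (auto simp: I_def)
      moreover have "card (F j) \<le> D" if "j < s" for j using t(4) that by (auto simp: small_subsets_def)
      ultimately show "measure_pmf.prob (pairs_pmf n p) (bad s t) \<le> exp (- (p ^ D * s * x))"
        unfolding bad_def t(1) prod.case using t assms by (intro prob_not_hits) auto
    qed
    also have "\<dots> \<le> 1 / (real n + 1) ^ 3"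
      by (rule union_bound_le[OF assms(3) that _ cardK]) (use that in \<open>simp add: algebra_simps\<close>)
    finally show ?thesis .
  qed
  have "{X. \<exists>a b. a \<le> b \<and> b \<le> n \<and> \<not> expands X n D x ({a..<b} - Q)} \<subseteq> (\<Union>s\<in>{1..n}. \<Union>t\<in>K s. bad s t)"
  proof
    fix X assume "X \<in> {X. \<exists>a b. a \<le> b \<and> b \<le> n \<and> \<not> expands X n D x ({a..<b} - Q)}"
    then obtain a b where ab: "a \<le> b" "b \<le> n" "\<not> expands X n D x (I a b)" by (auto simp: I_def)
    then obtain s F Z where s: "0 < s" "s \<le> n" "\<forall>j<s. F j \<subseteq> {..<n} - I a b \<and> card (F j) \<le> D"
      "disjoint_family_on F {..<s}" "Z \<subseteq> I a b" "card Z < s" "x \<le> card (I a b - Z)"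
      "\<not> hits X F {..<s} (I a b - Z)" unfolding expands_def by blast
    \<comment> \<open>Restriction makes \<open>F\<close> one of the extensional functions counted in
      \<open>K s\<close> without affecting \<open>hits\<close>.\<close>
    let ?F = "restrict F {..<s}"
    have "Z \<subseteq> {..<n}" using s(5) ab(2) by (auto simp: I_def)
    then have "(a, b, ?F, Z) \<in> K s"
      using s ab by (auto simp: K_def small_subsets_def disjoint_family_on_def)
    moreover have "X \<in> bad s (a, b, ?F, Z)" using s(8) by (auto simp: bad_def hits_def)
    moreover have "s \<in> {1..n}" using s by simp
    ultimately show "X \<in> (\<Union>s\<in>{1..n}. \<Union>t\<in>K s. bad s t)" by blast
  qed
  then have "measure_pmf.prob (pairs_pmf n p) {X. \<exists>a b. a \<le> b \<and> b \<le> n \<and> \<not> expands X n D x ({a..<b} - Q)}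
      \<le> measure_pmf.prob (pairs_pmf n p) (\<Union>s\<in>{1..n}. \<Union>t\<in>K s. bad s t)"
    by (intro measure_pmf.finite_measure_mono) auto
  also have "\<dots> \<le> real (card {1..n}) * (1 / (real n + 1) ^ 3)"
    using bad_le by (intro prob_UN_le) auto
  also have "\<dots> \<le> 1 / (real n + 1)\<^sup>2" using n_over_cube[of n] by (simp add: add.commute)
  finally show ?thesis .
qed

text \<open>The roles are exchanged: now at least \<open>m / 2 >= x\<close> cliques form the large
  side, and the union bound runs over the size \<open>y\<close> of \<open>Y\<close>. As
  \<open>card T < y\<close>, there are at most \<open>(n + 1) ^ (y + y)\<close> pairs. The cliques
  are fixed in advance and cost nothing.\<close>

lemma prob_not_covers:
  assumes "0 \<le> p" "p \<le> 1" "real (D + 6) * ln (real n + 1) \<le> p ^ D * real x" "2 * x \<le> m" "m \<le> n"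
    and "disjoint_family_on q {..<m}" "\<And>j. j < m \<Longrightarrow> q j \<subseteq> {..<n} \<and> card (q j) \<le> D"
  shows "measure_pmf.prob (pairs_pmf n p) {X. \<not> covers X n m q} \<le> 1 / (real n + 1)\<^sup>2"
proof -
  define K where "K y = {(Y, T). Y \<in> small_subsets n y \<and> T \<in> small_subsets n y \<and> card Y = y \<and>
    Y \<subseteq> {..<n} - (\<Union>j<m. q j) \<and> T \<subseteq> {..<m} \<and> m \<le> 2 * card ({..<m} - T)}" for y
  define bad where "bad = (\<lambda>(Y, T). {X. \<not> hits X q ({..<m} - T) Y})"
  let ?K = "\<lambda>y. small_subsets n y \<times> small_subsets n y"
  have sub: "K y \<subseteq> ?K y" for y by (auto simp: K_def)
  have fin: "finite (?K y)" for y by (intro finite_cartesian_product finite_small_subsets)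
  have cardK: "card (K y) \<le> (n + 1) ^ (y + y)" for y
  proof -
    have "card (K y) \<le> card (?K y)" by (intro card_mono fin sub)
    also have "\<dots> \<le> (n + 1) ^ y * (n + 1) ^ y"
      unfolding card_cartesian_product by (intro mult_le_mono card_small_subsets)
    finally show ?thesis by (simp add: power_add)
  qed
  have bad_le: "measure_pmf.prob (pairs_pmf n p) (\<Union>t\<in>K y. bad t) \<le> 1 / (real n + 1) ^ 3" if "1 \<le> y" for y
  proof -
    have "measure_pmf.prob (pairs_pmf n p) (\<Union>t\<in>K y. bad t) \<le> real (card (K y)) * exp (- (p ^ D * y * x))"
    proof (rule prob_UN_le)
      show "finite (K y)" using finite_subset[OF sub fin] .
      fix t assume "t \<in> K y"
      then obtain Y T where t: "t = (Y, T)" "card Y = y" "Y \<subseteq> {..<n} - (\<Union>j<m. q j)" "T \<subseteq> {..<m}"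
        "m \<le> 2 * card ({..<m} - T)"
        by (auto simp: K_def)
      have "measure_pmf.prob (pairs_pmf n p) (bad t) \<le> exp (- (p ^ D * x * y))"
        unfolding bad_def t(1) prod.case
      proof (rule prob_not_hits)
        fix j assume "j \<in> {..<m} - T"
        then show "q j \<subseteq> {..<n} - Y \<and> card (q j) \<le> D" using assms(7)[of j] t(3) by auto
      next
        show "disjoint_family_on q ({..<m} - T)"
          using assms(6) by (auto simp: disjoint_family_on_def)
      qed (use t assms in auto)
      then show "measure_pmf.prob (pairs_pmf n p) (bad t) \<le> exp (- (p ^ D * y * x))" by (simp add: mult_ac)
    qed
    also have "\<dots> \<le> 1 / (real n + 1) ^ 3"
      by (rule union_bound_le[OF assms(3) that _ cardK]) (use that in \<open>simp add: algebra_simps\<close>)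
    finally show ?thesis .
  qed
  have "{X. \<not> covers X n m q} \<subseteq> (\<Union>y\<in>{1..n}. \<Union>t\<in>K y. bad t)"
  proof
    fix X assume "X \<in> {X. \<not> covers X n m q}"
    then obtain Y T where s: "Y \<subseteq> {..<n} - (\<Union>j<m. q j)" "T \<subseteq> {..<m}" "card T < card Y"
      "m \<le> 2 * card ({..<m} - T)" "\<not> hits X q ({..<m} - T) Y" unfolding covers_def by blast
    have "(Y, T) \<in> K (card Y)"
      using s assms(5) by (auto simp: K_def small_subsets_def)
    moreover have "X \<in> bad (Y, T)" using s by (auto simp: bad_def)
    moreover have "card Y \<le> card {..<n}" using s(1) by (intro card_mono) auto
    then have "card Y \<in> {1..n}" using s(3) by simp
    ultimately show "X \<in> (\<Union>y\<in>{1..n}. \<Union>t\<in>K y. bad t)" by blast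
  qed
  then have "measure_pmf.prob (pairs_pmf n p) {X. \<not> covers X n m q}
      \<le> measure_pmf.prob (pairs_pmf n p) (\<Union>y\<in>{1..n}. \<Union>t\<in>K y. bad t)"
    by (intro measure_pmf.finite_measure_mono) auto
  also have "\<dots> \<le> real (card {1..n}) * (1 / (real n + 1) ^ 3)"
    using bad_le by (intro prob_UN_le) auto
  also have "\<dots> \<le> 1 / (real n + 1)\<^sup>2" using n_over_cube[of n] by (simp add: add.commute)
  finally show ?thesis .
qed

section \<open>Universality\<close>

lemma hits_mono: "hits X F S Y \<Longrightarrow> (\<And>e. X e \<Longrightarrow> X' e) \<Longrightarrow> hits X' F S Y"
  unfolding hits_def by blast

lemma expands_mono: "expands X n D x I \<Longrightarrow> (\<And>e. X e \<Longrightarrow> X' e) \<Longrightarrow> expands X' n D x I"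
  unfolding expands_def using hits_mono[of X _ _ _ X'] by blast

lemma covers_mono: "covers X n m q \<Longrightarrow> (\<And>e. X e \<Longrightarrow> X' e) \<Longrightarrow> covers X' n m q"
  unfolding covers_def using hits_mono[of X _ _ _ X'] by blast

section \<open>Degrees and density\<close>

lemma card_edges_at:
  assumes "E \<subseteq> vertex_pairs V"
  shows "card {e \<in> E. v \<in> e} = card {u. {u, v} \<in> E}"
proof -
  have "{e \<in> E. v \<in> e} = (\<lambda>u. {u, v}) ` {u. {u, v} \<in> E}"
  proof (intro equalityI subsetI)
    fix e assume e: "e \<in> {e \<in> E. v \<in> e}"
    then obtain a b where "e = {a, b}" using assms by (auto simp: vertex_pairs_def card_2_iff)
    then show "e \<in> (\<lambda>u. {u, v}) ` {u. {u, v} \<in> E}" using e by (auto simp: insert_commute)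
  qed auto
  moreover have "inj_on (\<lambda>u. {u, v}) {u. {u, v} \<in> E}" by (auto simp: inj_on_def doubleton_eq_iff)
  ultimately show ?thesis by (simp add: card_image)
qed

lemma sum_card_edges_at:
  assumes "finite R" "F \<subseteq> vertex_pairs R"
  shows "(\<Sum>v\<in>R. card {e \<in> F. v \<in> e}) = 2 * card F"
proof -
  have "finite F" using finite_subset[OF assms(2) finite_vertex_pairs[OF assms(1)]] .
  moreover have "card {v \<in> R. v \<in> e} = 2" if "e \<in> F" for e
  proof -
    have "{v \<in> R. v \<in> e} = e" using assms(2) that by (auto simp: vertex_pairs_def)
    then show ?thesis using assms(2) that by (auto simp: vertex_pairs_def)
  qed
  ultimately have "(\<Sum>v\<in>R. card {e \<in> F. v \<in> e}) = 2 * card F"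
    using assms(1) by (intro sum_multicount) auto
  then show ?thesis .
qed

lemma card_edges_le_density:
  assumes "simple_graph H" "R \<subseteq> verts H" "R \<noteq> {}" "max_density H \<le> real d"
  shows "2 * card {e \<in> edges H. e \<subseteq> R} \<le> d * card R"
proof -
  let ?S = "{2 * real (card (edges K)) / real (card (verts K)) | K. subgraph K H \<and> verts K \<noteq> {}}"
  have fin: "finite (verts H)" "finite (edges H)"
    using assms(1) finite_vertex_pairs finite_subset by (auto simp: simple_graph_def)
  have "?S \<subseteq> (\<lambda>(A, B). 2 * real (card B) / real (card A)) ` (Pow (verts H) \<times> Pow (edges H))"
    by (auto simp: subgraph_def)
  then have finS: "finite ?S" using fin by (rule_tac finite_subset) auto
  have finR: "finite R" using assms(2) fin finite_subset by blast
  let ?K = "(R, {e \<in> edges H. e \<subseteq> R})"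
  have "subgraph ?K H"
    using assms(1,2) finR by (auto simp: subgraph_def simple_graph_def vertex_pairs_def)
  then have "2 * real (card (edges ?K)) / real (card (verts ?K)) \<in> ?S" using assms(3) by fastforce
  then have "2 * real (card {e \<in> edges H. e \<subseteq> R}) / real (card R) \<le> max_density H"
    unfolding max_density_def using finS by (intro Max_ge) auto
  also have "\<dots> \<le> real d" by fact
  finally have "2 * real (card {e \<in> edges H. e \<subseteq> R}) \<le> real d * real (card R)"
    using assms(3) finR by (simp add: divide_le_eq card_gt_0_iff)
  then show ?thesis by (metis of_nat_le_iff of_nat_mult of_nat_numeral)
qed

text \<open>The handshake lemma in the subgraph induced by \<open>R\<close> turns the density bound
  into a degree-sum bound with \<open>d\<close>; the maximum degree gives one with
  \<open>\<Delta>\<close>.\<close>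

lemma graph_family_sparse:
  assumes "H \<in> graph_family n \<Delta> (real d)" "1 \<le> n"
  shows "sparse_graph (verts H) (edges H) \<Delta> (min d \<Delta>)"
proof -
  have H: "simple_graph H" "card (verts H) = n" "max_degree H \<le> \<Delta>" "max_density H \<le> real d"
    using assms(1) by (auto simp: graph_family_def)
  have fin: "finite (verts H)" and E: "edges H \<subseteq> vertex_pairs (verts H)"
    using H(1) by (auto simp: simple_graph_def)
  have deg: "card {u. {u, v} \<in> edges H} \<le> \<Delta>" if "v \<in> verts H" for v
  proof -
    have "degree H v \<le> max_degree H" unfolding max_degree_def using fin that by (intro Max_ge) auto
    then show ?thesis using H(3) card_edges_at[OF E, of v] by (simp add: degree_def)
  qed
  have "(\<Sum>v\<in>R. card ({u. {u, v} \<in> edges H} \<inter> R)) \<le> min d \<Delta> * card R" if R: "R \<subseteq> verts H" for R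
  proof -
    have finR: "finite R" using R fin finite_subset by blast
    let ?F = "{e \<in> edges H. e \<subseteq> R}"
    have F: "?F \<subseteq> vertex_pairs R" using E by (auto simp: vertex_pairs_def)
    have "(\<Sum>v\<in>R. card ({u. {u, v} \<in> edges H} \<inter> R)) = (\<Sum>v\<in>R. card {e \<in> ?F. v \<in> e})"
    proof (rule sum.cong)
      fix v assume "v \<in> R"
      then have "{u. {u, v} \<in> edges H} \<inter> R = {u. {u, v} \<in> ?F}" by auto
      then show "card ({u. {u, v} \<in> edges H} \<inter> R) = card {e \<in> ?F. v \<in> e}"
        using card_edges_at[OF F, of v] by simp
    qed simp
    also have "\<dots> = 2 * card ?F" by (rule sum_card_edges_at[OF finR F])
    also have "\<dots> \<le> d * card R"
    proof (cases "R = {}")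
      case True
      then have "?F = {}" using F by (auto simp: vertex_pairs_def)
      then have "card ?F = 0" by (simp only: card.empty)
      then show ?thesis by linarith
    qed (use card_edges_le_density[OF H(1) R _ H(4)] in auto)
    finally have 1: "(\<Sum>v\<in>R. card ({u. {u, v} \<in> edges H} \<inter> R)) \<le> d * card R" .
    have "card ({u. {u, v} \<in> edges H} \<inter> R) \<le> \<Delta>" if "v \<in> R" for v
    proof -
      have "{u. {u, v} \<in> edges H} \<subseteq> verts H" using E by (auto simp: vertex_pairs_def)
      then have "card ({u. {u, v} \<in> edges H} \<inter> R) \<le> card {u. {u, v} \<in> edges H}"
        using fin finite_subset by (intro card_mono) auto
      then show ?thesis using deg[of v] that R by auto
    qed
    then have "(\<Sum>v\<in>R. card ({u. {u, v} \<in> edges H} \<inter> R)) \<le> \<Delta> * card R"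
      using sum_bounded_above[of R "\<lambda>v. card ({u. {u, v} \<in> edges H} \<inter> R)" \<Delta>] by (simp add: mult.commute)
    then show ?thesis using 1 by (simp add: min_def)
  qed
  then show ?thesis using fin E deg by unfold_locales auto
qed

section \<open>From embeddings to universality\<close>

lemma contains_copyI:
  assumes "simple_graph H" "inj_on f (verts H)" "f ` verts H \<subseteq> {..<n}"
    and "\<And>u v. {u, v} \<in> edges H \<Longrightarrow> X {f u, f v}"
  shows "contains_copy ({..<n}, {e \<in> vertex_pairs {..<n}. X e}) H"
proof -
  let ?H = "(f ` verts H, (\<lambda>e. f ` e) ` edges H)"
  have E: "\<exists>u v. e = {u, v} \<and> u \<noteq> v \<and> u \<in> verts H \<and> v \<in> verts H" if "e \<in> edges H" for e
  proof -
    have "e \<subseteq> verts H" "card e = 2" using assms(1) that by (auto simp: simple_graph_def vertex_pairs_def)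
    then show ?thesis unfolding card_2_iff by blast
  qed
  have im: "f ` e \<in> vertex_pairs (f ` verts H) \<and> X (f ` e)" if e: "e \<in> edges H" for e
  proof -
    obtain u v where uv: "e = {u, v}" "u \<noteq> v" "u \<in> verts H" "v \<in> verts H" using E[OF e] by blast
    then have "f u \<noteq> f v" using assms(2) by (auto simp: inj_on_def)
    then show ?thesis using uv assms(4)[of u v] e by (auto simp: vertex_pairs_def card_insert_if)
  qed
  have "subgraph ?H ({..<n}, {e \<in> vertex_pairs {..<n}. X e})"
    using im assms(1,3) by (fastforce simp: subgraph_def simple_graph_def vertex_pairs_def)
  moreover have "isomorphic H ?H"
    using assms(2) by (auto simp: isomorphic_def bij_betw_def)
  ultimately show ?thesis by (auto simp: contains_copy_def)
qed

text \<open>Cliques come from \<open>X\<close>, expansion and covering from \<open>Y\<close>, and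
  all persist in the union. \<open>H\<close> only selects \<open>k\<close>, so hypotheses for every
  \<open>k <= \<delta>\<close> serve the whole family at once.\<close>

lemma contains_copy_of_family:
  assumes "H \<in> graph_family n \<Delta> (real d)" "1 \<le> n"
    and \<delta>: "\<delta> = min d \<Delta>" and D: "D = min (2 * \<delta>) \<Delta>"
    and q: "\<And>k. k \<le> \<delta> \<Longrightarrow> disjoint_family_on (q k) {..<m} \<and> (\<forall>j<m. q k j \<subseteq> {..<n} \<and> card (q k j) = k \<and>
           (\<forall>u\<in>q k j. \<forall>v\<in>q k j. u \<noteq> v \<longrightarrow> X {u, v}))"
    and exp: "\<And>k a b. k \<le> \<delta> \<Longrightarrow> a \<le> b \<Longrightarrow> b \<le> n \<Longrightarrow> expands Y n D x ({a..<b} - (\<Union>j<m. q k j))"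
    and cov: "\<And>k. k \<le> \<delta> \<Longrightarrow> covers Y n m (q k)"
    and \<tau>: "n * ((\<delta> + 1) * (\<Delta> + 1)\<^sup>2 - 1) ^ \<tau> < ((\<delta> + 1) * (\<Delta> + 1)\<^sup>2) ^ \<tau>"
    and m: "2 * (\<tau> + 1) * x \<le> m" "m * ((\<delta> + 1)\<^sup>2 * (\<Delta> + 1) ^ 4) \<le> n"
  shows "contains_copy ({..<n}, {e \<in> vertex_pairs {..<n}. X e \<or> Y e}) H"
proof -
  have H: "simple_graph H" "card (verts H) = n" using assms(1) by (auto simp: graph_family_def)
  interpret sparse_graph "verts H" "edges H" \<Delta> \<delta>
    using graph_family_sparse[OF assms(1,2)] \<delta> by simp
  have "m * ((\<delta> + 1)\<^sup>2 * (\<Delta> + 1) ^ 4) \<le> card (verts H)" using m(2) H(2) by simp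
  from exists_last_layer[OF this] obtain k W where W: "k \<le> \<delta>" "W \<subseteq> verts H" "card W = m"
    "\<forall>w\<in>W. card (N w) = k" "\<forall>u\<in>W. \<forall>v\<in>W. u \<noteq> v \<longrightarrow> v \<notin> nbhd 4 u" by (elim exE conjE)
  interpret separated "verts H" "edges H" \<Delta> \<delta> W k
    using W by unfold_locales auto
  have "\<exists>f. embeds (\<lambda>e. X e \<or> Y e) (verts H) f \<and> f ` verts H \<subseteq> {..<n}"
  proof (rule exists_embedding)
    show "expands (\<lambda>e. X e \<or> Y e) n D x ({a..<b} - (\<Union>j<m. q k j))" if "a \<le> b" "b \<le> n" for a b
      using expands_mono[OF exp[OF W(1) that]] by simp
    show "covers (\<lambda>e. X e \<or> Y e) n m (q k)" using covers_mono[OF cov[OF W(1)]] by simp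
    show "min (2 * \<delta>) \<Delta> \<le> D" using D by simp
    show "disjoint_family_on (q k) {..<m}" using q[OF W(1)] by simp
    show "q k j \<subseteq> {..<n} \<and> card (q k j) = k" if "j < m" for j using q[OF W(1)] that by simp
    show "X {u, v} \<or> Y {u, v}" if "j < m" "u \<in> q k j" "v \<in> q k j" "u \<noteq> v" for j u v
      using q[OF W(1)] that by simp
  qed (use H W \<tau> m in auto)
  then obtain f where f: "embeds (\<lambda>e. X e \<or> Y e) (verts H) f" "f ` verts H \<subseteq> {..<n}" by blast
  show ?thesis
  proof (rule contains_copyI[OF H(1) _ f(2)])
    show "inj_on f (verts H)" using f(1) by (simp add: embeds_def)
    fix u v assume "{u, v} \<in> edges H"
    then have "u \<in> N v" by (simp add: edge_iff)
    moreover have "u \<in> verts H" "v \<in> verts H" using N_subset calculation N_sym by blast+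
    ultimately show "X {f u, f v} \<or> Y {f u, f v}" using f(1) by (simp add: embeds_def)
  qed
qed

text \<open>Once \<open>X\<close> is fixed, so are its cliques \<open>q X k\<close>, and
  \<open>Y\<close> is still fresh. The union bound runs over the \<open>\<delta> + 1\<close> values
  of \<open>k\<close> and never over \<open>H\<close>, so the failure probability is at most
  \<open>(1 + 2 * (\<delta> + 1)) / (n + 1)^2 <= 3 / (n + 1)\<close>.\<close>

lemma prob_universal_ge:
  assumes "1 \<le> n" and \<delta>: "\<delta> = min d \<Delta>" and D: "D = min (2 * \<delta>) \<Delta>"
    and p: "0 \<le> p" "p \<le> 1" "real (D + 6) * ln (real n + 1) \<le> p ^ D * real x"
    and \<tau>: "n * ((\<delta> + 1) * (\<Delta> + 1)\<^sup>2 - 1) ^ \<tau> < ((\<delta> + 1) * (\<Delta> + 1)\<^sup>2) ^ \<tau>"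
    and m: "2 * (\<tau> + 1) * x \<le> m" "m * ((\<delta> + 1)\<^sup>2 * (\<Delta> + 1) ^ 4) \<le> n"
    and n: "m \<le> n" "\<delta> * (m + x) \<le> n" "\<delta> \<le> n"
  shows "1 - 3 / (real n + 1) \<le> measure_pmf.prob (random_graph n (1 - (1 - p)\<^sup>2))
    {G. universal G (graph_family n \<Delta> (real d))}"
proof -
  let ?P = "pairs_pmf n p" and ?c = "1 / (real n + 1)\<^sup>2"
  define G where "G = {X. \<forall>a b. a \<le> b \<and> b \<le> n \<longrightarrow> expands X n D x ({a..<b} - {})}"
  have "- G = {X. \<exists>a b. a \<le> b \<and> b \<le> n \<and> \<not> expands X n D x ({a..<b} - {})}" by (auto simp: G_def)
  then have bad\<^sub>1: "measure_pmf.prob ?P (- G) \<le> ?c" using prob_not_expands[OF p, of "{}"] by simp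
  have \<delta>D: "\<delta> \<le> D" using \<delta> D by simp
  have "\<exists>q. disjoint_family_on q {..<m} \<and> (\<forall>j<m. q j \<subseteq> {..<n} \<and> card (q j) = k \<and>
           (\<forall>u\<in>q j. \<forall>v\<in>q j. u \<noteq> v \<longrightarrow> X {u, v}))" if "X \<in> G" "k \<le> \<delta>" for X k
  proof -
    have k: "k * (m + x) \<le> n" "k \<le> D + 1" using mult_le_mono1[OF that(2), of "m + x"] n(2) that(2) \<delta>D by linarith+
    have "\<exists>q. disjoint_family_on q {..<m} \<and> (\<forall>j<m. q j \<subseteq> {..<k * (m + x)} \<and> card (q j) = k \<and>
           (\<forall>u\<in>q j. \<forall>v\<in>q j. u \<noteq> v \<longrightarrow> X {u, v}))"
      using that(1) k by (intro exists_disjoint_cliques[of n X D x]) (auto simp: G_def)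
    moreover have "{..<k * (m + x)} \<subseteq> {..<n}" using k(1) by auto
    ultimately show ?thesis by (meson subset_trans)
  qed
  then obtain q where q: "\<And>X k. X \<in> G \<Longrightarrow> k \<le> \<delta> \<Longrightarrow> disjoint_family_on (q X k) {..<m} \<and>
      (\<forall>j<m. q X k j \<subseteq> {..<n} \<and> card (q X k j) = k \<and> (\<forall>u\<in>q X k j. \<forall>v\<in>q X k j. u \<noteq> v \<longrightarrow> X {u, v}))"
    by metis
  define U where "U = {(X, Y). universal ({..<n}, {e \<in> vertex_pairs {..<n}. X e \<or> Y e}) (graph_family n \<Delta> (real d))}"
  have "measure_pmf.prob (pair_pmf ?P ?P) (- U) \<le> measure_pmf.prob ?P (- G) + real (card {..\<delta>}) * (2 * ?c)"
  proof (rule prob_pair_pmf_le)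
    fix X assume X: "X \<in> G"
    let ?bad = "\<lambda>k. {Y. \<exists>a b. a \<le> b \<and> b \<le> n \<and> \<not> expands Y n D x ({a..<b} - (\<Union>j<m. q X k j))} \<union>
      {Y. \<not> covers Y n m (q X k)}"
    have "Y \<in> (\<Union>k\<in>{..\<delta>}. ?bad k)" if Y: "(X, Y) \<in> - U" for Y
    proof (rule ccontr)
      assume "\<not> ?thesis"
      then have "contains_copy ({..<n}, {e \<in> vertex_pairs {..<n}. X e \<or> Y e}) H"
        if "H \<in> graph_family n \<Delta> (real d)" for H
        by (intro contains_copy_of_family[OF that assms(1) \<delta> D q[OF X] _ _ \<tau> m]) auto
      then show False using Y by (auto simp: U_def universal_def)
    qed
    then have "measure_pmf.prob ?P {Y. (X, Y) \<in> - U} \<le> measure_pmf.prob ?P (\<Union>k\<in>{..\<delta>}. ?bad k)"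
      by (intro measure_pmf.finite_measure_mono) auto
    also have "\<dots> \<le> real (card {..\<delta>}) * (2 * ?c)"
    proof (rule prob_UN_le)
      fix k assume "k \<in> {..\<delta>}"
      then have k: "k \<le> \<delta>" by simp
      have "measure_pmf.prob ?P {Y. \<not> covers Y n m (q X k)} \<le> ?c"
      proof (rule prob_not_covers[OF p _ n(1)])
        show "2 * x \<le> m" using m(1) by (auto simp: algebra_simps)
      qed (use q[OF X k] k \<delta>D in auto)
      moreover have "measure_pmf.prob ?P {Y. \<exists>a b. a \<le> b \<and> b \<le> n \<and> \<not> expands Y n D x ({a..<b} - (\<Union>j<m. q X k j))} \<le> ?c"
        by (rule prob_not_expands[OF p])
      ultimately show "measure_pmf.prob ?P (?bad k) \<le> 2 * ?c"
        by (intro order_trans[OF measure_Un_le]) auto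
    qed simp
    finally show "measure_pmf.prob ?P {Y. (X, Y) \<in> - U} \<le> real (card {..\<delta>}) * (2 * ?c)" .
  qed simp
  also have "\<dots> \<le> 3 / (real n + 1)"
  proof -
    have "real (card {..\<delta>}) * (2 * ?c) \<le> (real n + 1) * (2 * ?c)" using n(3) by (intro mult_right_mono) auto
    also have "\<dots> = 2 / (real n + 1)"
    proof -
      have "a * (2 * (1 / a\<^sup>2)) = 2 / a" if "0 < a" for a :: real using that by (simp add: power2_eq_square)
      then show ?thesis by this simp
    qed
    finally have "real (card {..\<delta>}) * (2 * ?c) \<le> 2 / (real n + 1)" .
    moreover have "?c \<le> 1 / (real n + 1)" by (intro divide_left_mono) (auto simp: power2_eq_square)
    moreover have "1 / (real n + 1) + 2 / (real n + 1) = 3 / (real n + 1)"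
      by (simp add: add_divide_distrib[symmetric])
    ultimately show ?thesis using bad\<^sub>1 by linarith
  qed
  finally have "1 - 3 / (real n + 1) \<le> measure_pmf.prob (pair_pmf ?P ?P) U"
    using measure_pmf.prob_compl[of U "pair_pmf ?P ?P"] by (simp add: Compl_eq_Diff_UNIV)
  moreover have "random_graph n (1 - (1 - p)\<^sup>2) =
      map_pmf (\<lambda>(X, Y). ({..<n}, {e \<in> vertex_pairs {..<n}. X e \<or> Y e})) (pair_pmf ?P ?P)"
    unfolding random_graph_def pairs_pmf_def
    by (subst Pi_pmf_bernoulli_disj) (use p in \<open>auto simp: finite_vertex_pairs pmf.map_comp o_def case_prod_unfold\<close>)
  moreover have "(\<lambda>(X, Y). ({..<n}, {e \<in> vertex_pairs {..<n}. X e \<or> Y e})) -`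
      {G. universal G (graph_family n \<Delta> (real d))} = U" by (auto simp: U_def)
  ultimately show ?thesis by simp
qed

text \<open>\<open>(1 - 1 / q) ^ \<tau> <= exp (- \<tau> / q) < 1 / n\<close>.\<close>

lemma shrink_below_one:
  assumes "1 \<le> n" "1 \<le> q" "real q * ln (real n) < real \<tau>"
  shows "n * (q - 1) ^ \<tau> < q ^ \<tau>"
proof -
  have q: "real (q - 1) = real q * (1 - 1 / real q)" using assms(2) by (simp add: field_simps of_nat_diff)
  have "(1 - 1 / real q) ^ \<tau> \<le> exp (- (1 / real q)) ^ \<tau>"
    using exp_ge_add_one_self[of "- (1 / real q)"] assms(2) by (intro power_mono) auto
  also have "\<dots> = exp (- (real \<tau> / real q))" by (simp add: exp_of_nat_mult[symmetric])
  also have "\<dots> < exp (- ln (real n))" using assms(2,3) by (simp add: field_simps)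
  also have "\<dots> = 1 / real n" using assms(1) by (simp add: exp_minus inverse_eq_divide)
  finally have "real n * (1 - 1 / real q) ^ \<tau> < 1" using assms(1) by (simp add: field_simps)
  then have "real q ^ \<tau> * (real n * (1 - 1 / real q) ^ \<tau>) < real q ^ \<tau> * 1"
    using assms(2) by (intro mult_strict_left_mono) auto
  moreover have "real (n * (q - 1) ^ \<tau>) = real q ^ \<tau> * (real n * (1 - 1 / real q) ^ \<tau>)"
    by (simp only: of_nat_mult of_nat_power q power_mult_distrib mult_ac)
  ultimately have "real (n * (q - 1) ^ \<tau>) < real (q ^ \<tau>)"
    by (simp only: of_nat_power mult_1_right)
  then show ?thesis by (simp only: of_nat_less_iff)
qed

text \<open>Choice of parameters. From \<open>B / n <= p\<^sub>1 ^ D\<close> the slack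
  \<open>x\<close> is \<open>O(\<Delta> L n / B)\<close>; with \<open>O(\<Delta>^3 L)\<close>
  layers, \<open>m\<close> is \<open>O(\<Delta>^4 L^2 n / B)\<close>. The last layer costs a further
  factor \<open>O(\<Delta>^6)\<close>, so \<open>B\<close> has to exceed a multiple of
  \<open>\<Delta>^10 L^2\<close>.\<close>

lemma prob_universal_ge_of_large_p:
  fixes n \<Delta> d :: nat and p :: real
  assumes n: "3 \<le> n" and \<Delta>: "2 \<le> \<Delta>" and d: "2 \<le> d" and p: "0 \<le> p" "p \<le> 1"
    and large: "40000 \<le> p / (real \<Delta> ^ 12 * real n powr (- 1 / real (min (2 * d) \<Delta>)) * ln (real n) ^ 3)"
  shows "1 - 3 / (real n + 1) \<le> measure_pmf.prob (random_graph n p)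
    {G. universal G (graph_family n \<Delta> (real d))}"
proof -
  define \<delta> where "\<delta> = min d \<Delta>"
  define D where "D = min (2 * \<delta>) \<Delta>"
  define L where "L = ln (real n)"
  define B where "B = 20000 * real \<Delta> ^ 12 * L ^ 3"
  \<comment> \<open>Two independent rounds of this density make up density \<open>p\<close>.\<close>
  define p\<^sub>1 where "p\<^sub>1 = 1 - sqrt (1 - p)"
  define y where "y = real (D + 6) * ln (real n + 1) / p\<^sub>1 ^ D"
  define x where "x = nat \<lceil>y\<rceil>"
  define q where "q = (\<delta> + 1) * (\<Delta> + 1)\<^sup>2"
  \<comment> \<open>The added one makes \<open>real q * L < real \<tau>\<close> strict.\<close>
  define \<tau> where "\<tau> = nat \<lceil>real q * L\<rceil> + 1"
  define m where "m = 2 * (\<tau> + 1) * x"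
  have D: "D = min (2 * d) \<Delta>" "2 \<le> D" "D \<le> \<Delta>" "\<delta> \<le> \<Delta>" "2 \<le> \<delta>" using d \<Delta> by (auto simp: D_def \<delta>_def)
  have n0: "0 < real n" using n by simp
  \<comment> \<open>From \<open>n >= 3 > e\<close> follows \<open>L >= 1\<close>, so powers of
    \<open>L\<close> may be raised in upper bounds.\<close>
  have "exp 1 \<le> real n" using exp_le n by linarith
  then have L: "1 \<le> L" unfolding L_def using n0 by (simp add: ln_ge_iff)
  have ln1: "ln (real n + 1) \<le> 2 * L"
  proof -
    have "n + 1 \<le> n * n" using mult_le_mono1[of 2 n n] n by linarith
    then have "real n + 1 \<le> real n ^ 2" by (simp add: power2_eq_square flip: of_nat_mult of_nat_Suc)
    then have "ln (real n + 1) \<le> ln (real n ^ 2)" using n0 by (subst ln_le_cancel_iff) auto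
    then show ?thesis using n0 by (simp add: L_def ln_realpow)
  qed
  have \<Delta>0: "2 \<le> real \<Delta>" using \<Delta> by simp
  have L0: "0 < L" using L by simp
  have one_le: "1 \<le> real \<Delta> ^ i" "1 \<le> L ^ i" for i using \<Delta>0 L by (auto intro!: one_le_power)
  have "1 * 1 \<le> real \<Delta> ^ 12 * L ^ 3" using one_le by (intro mult_mono) auto
  then have B1: "1 \<le> B" by (simp add: B_def)
  have p1: "0 \<le> p\<^sub>1" "p\<^sub>1 \<le> 1" "1 - (1 - p\<^sub>1)\<^sup>2 = p" using p by (auto simp: p\<^sub>1_def)
  have half: "p / 2 \<le> p\<^sub>1"
  proof -
    have "sqrt (1 - p) \<le> 1 - p / 2"
      using p by (intro real_le_lsqrt) (auto simp: power2_eq_square algebra_simps)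
    then show ?thesis by (simp add: p\<^sub>1_def)
  qed
  let ?r = "real n powr (- 1 / real D)"
  have r: "0 < ?r" using n0 by simp
  have "B * ?r \<le> p / 2"
  proof -
    have "0 < real \<Delta> ^ 12 * ?r * L ^ 3" using \<Delta>0 L0 r by simp
    then have "40000 * (real \<Delta> ^ 12 * ?r * L ^ 3) \<le> p"
      using large unfolding D(1)[symmetric] L_def[symmetric] by (simp add: pos_le_divide_eq)
    then show ?thesis by (simp add: B_def mult_ac)
  qed
  then have "B * ?r \<le> p\<^sub>1" using half by linarith
  then have "(B * ?r) ^ D \<le> p\<^sub>1 ^ D" using B1 r by (intro power_mono) auto
  \<comment> \<open>The exponent \<open>- 1 / D\<close> is made for this: the \<open>D\<close>-th
    power of \<open>B * ?r\<close> is \<open>B ^ D / n >= B / n\<close>.\<close>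
  moreover have "?r ^ D = 1 / real n"
  proof -
    have "?r ^ D = real n powr (- 1 / real D * real D)" using n0 by (simp add: powr_powr flip: powr_realpow)
    also have "- 1 / real D * real D = - 1" using D(2) by simp
    finally show ?thesis using n0 by (simp add: powr_minus_divide)
  qed
  moreover have "B \<le> B ^ D" using B1 D(2) power_increasing[of 1 D B] by simp
  ultimately have pD: "B / real n \<le> p\<^sub>1 ^ D"
    using n0 by (simp add: power_mult_distrib) (meson divide_right_mono of_nat_0_le_iff order_trans)
  have pD0: "0 < p\<^sub>1 ^ D" using pD B1 n0 by (meson divide_pos_pos less_le_trans zero_less_one)
  have pD1: "p\<^sub>1 ^ D \<le> 1" using p1 by (simp add: power_le_one)
  have ln0: "1 \<le> ln (real n + 1)"
    using L n0 unfolding L_def by (meson le_less_trans less_add_one less_imp_le ln_le_cancel_iff order_trans add_pos_pos zero_less_one)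
  have y1: "1 \<le> y"
  proof -
    have "1 * 1 \<le> real (D + 6) * ln (real n + 1)" using ln0 by (intro mult_mono) auto
    then show ?thesis using pD0 pD1 unfolding y_def by (simp add: pos_le_divide_eq)
  qed
  have yx: "y \<le> real x" and x_le: "real x \<le> 2 * y" using y1 unfolding x_def by linarith+
  have y_le: "y \<le> 8 * real \<Delta> * L * real n / B"
  proof -
    have "real (D + 6) \<le> 4 * real \<Delta>" using D \<Delta> by simp
    then have "real (D + 6) * ln (real n + 1) \<le> (4 * real \<Delta>) * (2 * L)"
      using ln1 ln0 \<Delta>0 by (intro mult_mono) auto
    then have "y \<le> (4 * real \<Delta>) * (2 * L) / (B / real n)"
      unfolding y_def using pD pD0 B1 n0 ln0 L0 \<Delta>0 by (intro frac_le) auto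
    then show ?thesis by (simp add: mult_ac)
  qed
  have \<Delta>1: "real \<Delta> + 1 \<le> 2 * real \<Delta>" using \<Delta>0 by simp
  have \<delta>1: "real \<delta> + 1 \<le> 2 * real \<Delta>" using \<Delta>0 D(4) by simp
  have q_le: "real q \<le> 8 * real \<Delta> ^ 3"
  proof -
    have "real q = (real \<delta> + 1) * (real \<Delta> + 1)\<^sup>2" by (simp only: q_def of_nat_mult of_nat_power of_nat_add of_nat_1)
    also have "\<dots> \<le> (2 * real \<Delta>) * (2 * real \<Delta>)\<^sup>2"
      using \<Delta>1 \<delta>1 \<Delta>0 by (intro mult_mono power_mono) auto
    finally show ?thesis by (simp add: power2_eq_square power3_eq_cube)
  qed
  have \<tau>_le: "real \<tau> + 1 \<le> 9 * real \<Delta> ^ 3 * L"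
  proof -
    have "0 \<le> real q * L" using L0 by simp
    then have "real \<tau> \<le> real q * L + 2" unfolding \<tau>_def by linarith
    also have "real q * L \<le> 8 * real \<Delta> ^ 3 * L" using q_le L0 by (intro mult_right_mono) auto
    finally have "real \<tau> + 1 \<le> 8 * real \<Delta> ^ 3 * L + 3" by simp
    moreover have "(2::real) ^ 3 * 1 \<le> real \<Delta> ^ 3 * L" using \<Delta>0 L by (intro mult_mono power_mono) auto
    ultimately show ?thesis by simp
  qed
  have m_le: "real m \<le> 288 * real \<Delta> ^ 4 * L\<^sup>2 * real n / B"
  proof -
    have "real m = 2 * ((real \<tau> + 1) * real x)" by (simp add: m_def algebra_simps)
    also have "\<dots> \<le> 2 * ((9 * real \<Delta> ^ 3 * L) * (2 * (8 * real \<Delta> * L * real n / B)))"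
      using \<tau>_le x_le y_le L0 by (intro mult_left_mono mult_mono) auto
    finally show ?thesis by (simp add: power2_eq_square power3_eq_cube power4_eq_xxxx mult_ac)
  qed
  let ?w = "(\<delta> + 1)\<^sup>2 * (\<Delta> + 1) ^ 4"
  have w_le: "real ?w \<le> 64 * real \<Delta> ^ 6"
  proof -
    have "real ?w = (real \<delta> + 1)\<^sup>2 * (real \<Delta> + 1) ^ 4"
      by (simp only: of_nat_mult of_nat_power of_nat_add of_nat_1)
    also have "\<dots> \<le> (2 * real \<Delta>)\<^sup>2 * (2 * real \<Delta>) ^ 4"
      using \<Delta>1 \<delta>1 \<Delta>0 by (intro mult_mono power_mono) auto
    also have "\<dots> = 64 * real \<Delta> ^ 6" by (simp add: power_mult_distrib flip: power_add)
    finally show ?thesis .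
  qed
  have mw: "m * ?w \<le> n"
  proof -
    have "real (m * ?w) = real m * real ?w" by simp
    also have "\<dots> \<le> (288 * real \<Delta> ^ 4 * L\<^sup>2 * real n / B) * (64 * real \<Delta> ^ 6)"
      using m_le w_le B1 L0 by (intro mult_mono) auto
    also have "\<dots> = (18432 * real \<Delta> ^ 10 * L\<^sup>2) * real n / B" by (simp flip: power_add)
    also have "\<dots> \<le> real n"
    proof -
      \<comment> \<open>18432 is 288 * 64, from the bounds on \<open>m\<close> and
        \<open>?w\<close>; 20000 is half of 40000, because \<open>p\<^sub>1\<close> is only known to
        be at least \<open>p / 2\<close>.\<close>
      have "18432 * (real \<Delta> ^ 10 * L\<^sup>2) \<le> 20000 * (real \<Delta> ^ 12 * L ^ 3)"
        using \<Delta>0 L by (intro mult_mono power_increasing) auto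
      then have "18432 * real \<Delta> ^ 10 * L\<^sup>2 \<le> B" by (simp add: B_def)
      then have "(18432 * real \<Delta> ^ 10 * L\<^sup>2) * real n \<le> B * real n" by (intro mult_right_mono) auto
      then show ?thesis using B1 by (simp add: divide_le_eq mult.commute)
    qed
    finally show ?thesis by (simp only: of_nat_le_iff)
  qed
  have x1: "1 \<le> x" using yx y1 by linarith
  have xm: "x \<le> m" "1 \<le> m" using x1 by (auto simp: m_def)
  \<comment> \<open>With \<open>mw\<close> this gives \<open>2 * \<delta> * m <= n\<close>, from
    which the room for the cliques, \<open>m <= n\<close> and \<open>\<delta> <= n\<close>
    follow.\<close>
  have dw: "2 * \<delta> \<le> ?w"
  proof -
    have "2 * \<delta> * 1 \<le> (\<delta> + 1)\<^sup>2 * (\<Delta> + 1) ^ 4"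
      by (intro mult_le_mono) (auto simp: power2_eq_square)
    then show ?thesis by simp
  qed
  have dm: "2 * \<delta> * m \<le> n"
    using le_trans[OF mult_le_mono2[OF dw, of m] mw] by (simp only: mult.commute)
  have "1 - 3 / (real n + 1) \<le> measure_pmf.prob (random_graph n (1 - (1 - p\<^sub>1)\<^sup>2))
    {G. universal G (graph_family n \<Delta> (real d))}"
  proof (rule prob_universal_ge[OF _ \<delta>_def D_def p1(1,2) _ _ _ mw])
    show "real (D + 6) * ln (real n + 1) \<le> p\<^sub>1 ^ D * real x"
      using yx pD0 unfolding y_def by (simp add: divide_le_eq mult.commute)
    show "n * ((\<delta> + 1) * (\<Delta> + 1)\<^sup>2 - 1) ^ \<tau> < ((\<delta> + 1) * (\<Delta> + 1)\<^sup>2) ^ \<tau>"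
      unfolding q_def[symmetric]
    proof (rule shrink_below_one)
      show "real q * ln (real n) < real \<tau>" unfolding \<tau>_def L_def[symmetric] by linarith
      show "1 \<le> q" by (simp add: q_def Suc_le_eq del: mult_Suc)
    qed (use n in simp)
    show "2 * (\<tau> + 1) * x \<le> m" by (simp add: m_def)
    have "\<delta> * (m + x) \<le> \<delta> * (2 * m)" using xm by (intro mult_le_mono2) simp
    also have "\<dots> = 2 * \<delta> * m" by simp
    finally show "\<delta> * (m + x) \<le> n" using dm by (rule le_trans)
    have "2 * 2 * m \<le> 2 * \<delta> * m" using D(5) by (intro mult_le_mono) auto
    then show "m \<le> n" using dm by linarith
    have "\<delta> * 1 \<le> \<delta> * m" using xm by (intro mult_le_mono2) simp
    then show "\<delta> \<le> n" using dm by linarith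
  qed (use n in auto)
  then show ?thesis unfolding p1(3) .
qed

theorem theorem1p1:
  fixes \<Delta> d :: "nat \<Rightarrow> nat" and p :: "nat \<Rightarrow> real"
  assumes "\<And>n. n \<ge> 1 \<Longrightarrow> \<Delta> n > 1"
    and "\<And>n. n \<ge> 1 \<Longrightarrow> d n \<ge> 2"
    and "\<And>n. n \<ge> 1 \<Longrightarrow> 0 \<le> p n \<and> p n \<le> 1"
    and "filterlim
           (\<lambda>n. p n / (real (\<Delta> n) ^ 12
                        * real n powr (- 1 / real (min (2 * d n) (\<Delta> n)))
                        * ln (real n) ^ 3))
           at_top sequentially"
  shows "(\<lambda>n. measure_pmf.prob (random_graph n (p n))
            {G. universal G (graph_family n (\<Delta> n) (real (d n)))}) \<longlonglongrightarrow> 1"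
proof (rule tendsto_sandwich)
  have "\<forall>\<^sub>F n in sequentially. 40000 \<le> p n / (real (\<Delta> n) ^ 12
      * real n powr (- 1 / real (min (2 * d n) (\<Delta> n))) * ln (real n) ^ 3)"
    using assms(4) by (simp add: filterlim_at_top)
  then show "\<forall>\<^sub>F n in sequentially. 1 - 3 / (real n + 1) \<le> measure_pmf.prob (random_graph n (p n))
      {G. universal G (graph_family n (\<Delta> n) (real (d n)))}"
    using eventually_ge_at_top[of 3]
  proof eventually_elim
    case (elim n)
    then show ?case
      using assms(1-3)[of n] by (intro prob_universal_ge_of_large_p) auto
  qed
  show "(\<lambda>n. 1 - 3 / (real n + 1)) \<longlonglongrightarrow> 1" by real_asymp
qed auto

end
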